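(* Let $(X,d)$ be a complete metric space, let $f_1,\dots,f_N : X\to X$ be contracting similitudes with contraction factors $r_1,\dots,r_N\in(0,1)$, let $K$ be their invariant set, $\alpha$ their similarity dimension, $\mu$ the image measure on $K$, $B=\partial_s K$ the similarity boundary of $K$, $U=K\setminus B$, and $K_i=f_i(K)$. Assume that the similarity boundary is inverse invariant, i.e. $f_i^{-1}(B)\cap K\subseteq B$ for all $i=1,\dots,N$. Then the following are equivalent: (1) $\{f_i\}_{i=1}^N$ satisfies the condition $\overline{\mathrm{SOSC}}_K$; (2) $\dim_H K=\alpha$; (3) $U\neq\emptyset$; (4) $\operatorname{int} B=\emptyset$, the interior being taken in $K$; (5) $\mu(K_i)=r_i^{\alpha}$ for all $i=1,\dots,N$; (6) $\mu(K_i\cap K_j)=0$ for all $i\neq j$; (7) $\mu(B)=0$.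
   Context: A contracting similitude with contraction factor $r\in(0,1)$ is a map $f:X\to X$ with $d(f(x),f(y))=r\,d(x,y)$ for all $x,y\in X$ (it need not be onto). The invariant set (self-similar set) $K$ is the unique non-empty compact subset of $X$ with $K=\bigcup_{i=1}^N f_i(K)$. The similarity dimension $\alpha$ is the unique real number with $\sum_{i=1}^N r_i^{\alpha}=1$. $\dim_H$ is Hausdorff dimension with respect to $d$. For a map $f_i$ and a set $S$, $f_i^{-1}(S)$ denotes the preimage in $X$. Image measure: let $\Omega=\prod_{1}^{\infty}\{1,\dots,N\}$ be the sequence space with the product topology and let $\nu$ be the Borel probability measure on $\Omega$ determined by $\nu(C_{i_1\cdots i_n})=(r_{i_1}\cdots r_{i_n})^{\alpha}$, where $C_{i_1\cdots i_n}$ is the cylinder set of sequences whose first $n$ coordinates are $(i_1,\dots,i_n)$. Let $g:\Omega\to K$ be the continuous map sending $(i_1,i_2,\dots)$ to the unique point of $\bigcap_{n} f_{i_1}\circ\cdots\circ f_{i_n}(K)$ (equivalently the limit of these sets in the Hausdorff metric). The image measure is $\mu(A)=\nu(g^{-1}(A))$ for $A\subseteq K$. Similarity boundary: $B=\partial_sK=\bigcup_{j\neq k} f_j^{-1}\big(f_j(K)\cap f_k(K)\big)$, the union over all ordered pairs $(j,k)$ with $j\ne k$; it is a closed subset of $K$. $\overline{\mathrm{SOSC}}_K$ (strong open set condition in $K$): there exists a non-empty set $V\subseteq K$, open in $K$, such that $f_i(V)\subseteq V$ for all $i$ and $f_i(V)\cap f_j(K)=\emptyset$ for all $i\neq j$.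 *)

theory Defs
  imports "HOL-Probability.Probability"
begin

section \<open>Iterated function systems\<close>

text \<open>A system is given by maps \<open>f i\<close> and ratios \<open>r i\<close> for \<open>i \<in> {1..N}\<close>; the values at all
  other indices are never used.\<close>

definition contracting_similitude :: "real \<Rightarrow> ('a::metric_space \<Rightarrow> 'a) \<Rightarrow> bool" where
  "contracting_similitude r f \<longleftrightarrow> 0 < r \<and> r < 1 \<and> (\<forall>x y. dist (f x) (f y) = r * dist x y)"

definition invariant_set :: "nat \<Rightarrow> (nat \<Rightarrow> 'a::metric_space \<Rightarrow> 'a) \<Rightarrow> 'a set \<Rightarrow> bool" where
  "invariant_set N f K \<longleftrightarrow> K \<noteq> {} \<and> compact K \<and> K = (\<Union>i\<in>{1..N}. f i ` K)"

definition similarity_dimension :: "nat \<Rightarrow> (nat \<Rightarrow> real) \<Rightarrow> real \<Rightarrow> bool" where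
  "similarity_dimension N r \<alpha> \<longleftrightarrow> (\<Sum>i=1..N. r i powr \<alpha>) = 1"

definition similarity_boundary :: "nat \<Rightarrow> (nat \<Rightarrow> 'a \<Rightarrow> 'a) \<Rightarrow> 'a set \<Rightarrow> 'a set" where
  "similarity_boundary N f K =
     (\<Union>j\<in>{1..N}. \<Union>k\<in>{1..N} - {j}. f j -` (f j ` K \<inter> f k ` K))"

definition SOSC_in :: "nat \<Rightarrow> (nat \<Rightarrow> 'a::metric_space \<Rightarrow> 'a) \<Rightarrow> 'a set \<Rightarrow> bool" where
  "SOSC_in N f K \<longleftrightarrow>
     (\<exists>V. V \<noteq> {} \<and> V \<subseteq> K \<and> openin (top_of_set K) V \<and>
          (\<forall>i\<in>{1..N}. f i ` V \<subseteq> V) \<and>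
          (\<forall>i\<in>{1..N}. \<forall>j\<in>{1..N}. i \<noteq> j \<longrightarrow> f i ` V \<inter> f j ` K = {}))"


section \<open>Hausdorff measure and dimension\<close>

text \<open>The weight \<open>(diam S)\<^sup>s\<close> with the usual conventions that \<open>\<emptyset>\<close> has weight 0 and that
  a nonempty set has weight 1 when \<open>s = 0\<close> (whereas \<open>0 powr 0 = 0\<close>).\<close>

definition diam_weight :: "real \<Rightarrow> 'a::metric_space set \<Rightarrow> ennreal" where
  "diam_weight s S =
     (if S = {} then 0 else if s = 0 then 1 else ennreal (diameter S powr s))"

text \<open>Boundedness is required separately because \<^const>\<open>diameter\<close> is real-valued and hence
  meaningless on unbounded sets.\<close>

definition hausdorff_measure_at :: "real \<Rightarrow> real \<Rightarrow> 'a::metric_space set \<Rightarrow> ennreal" where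
  "hausdorff_measure_at \<delta> s A =
     (INF E\<in>{E :: nat \<Rightarrow> 'a set. A \<subseteq> (\<Union>n. E n) \<and> (\<forall>n. bounded (E n) \<and> diameter (E n) \<le> \<delta>)}.
        (\<Sum>n. diam_weight s (E n)))"

definition hausdorff_measure :: "real \<Rightarrow> 'a::metric_space set \<Rightarrow> ennreal" where
  "hausdorff_measure s A = (SUP \<delta>\<in>{0<..}. hausdorff_measure_at \<delta> s A)"

definition hausdorff_dim :: "'a::metric_space set \<Rightarrow> ereal" where
  "hausdorff_dim A = Inf {ereal s | s. 0 \<le> s \<and> hausdorff_measure s A = 0}"


section \<open>The image measure\<close>

text \<open>Sequences \<open>\<omega>\<close> are indexed from 0, so \<open>\<omega> 0\<close> is the first coordinate.\<close>

definition code_space :: "nat \<Rightarrow> (nat \<Rightarrow> nat) set" where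
  "code_space N = (UNIV \<rightarrow> {1..N})"

definition cylinder :: "nat \<Rightarrow> nat list \<Rightarrow> (nat \<Rightarrow> nat) set" where
  "cylinder N w = {\<omega> \<in> code_space N. \<forall>k<length w. \<omega> k = w ! k}"

text \<open>The topology of \<^typ>\<open>nat \<Rightarrow> nat\<close> is the product of the discrete topologies, so the
  \<open>\<sigma>\<close>-algebra below consists of the Borel sets of the product space \<^term>\<open>code_space N\<close>.\<close>

definition is_code_measure :: "nat \<Rightarrow> (nat \<Rightarrow> real) \<Rightarrow> real \<Rightarrow> (nat \<Rightarrow> nat) measure \<Rightarrow> bool" where
  "is_code_measure N r \<alpha> \<nu> \<longleftrightarrow>
     prob_space \<nu> \<and> sets \<nu> = sets (restrict_space borel (code_space N)) \<and>
     (\<forall>w\<in>lists {1..N}. measure \<nu> (cylinder N w) = (\<Prod>i\<leftarrow>w. r i) powr \<alpha>)"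

definition code_measure :: "nat \<Rightarrow> (nat \<Rightarrow> real) \<Rightarrow> real \<Rightarrow> (nat \<Rightarrow> nat) measure" where
  "code_measure N r \<alpha> = (THE \<nu>. is_code_measure N r \<alpha> \<nu>)"

text \<open>\<open>word_map f \<omega> n = f (\<omega> 0) \<circ> \<dots> \<circ> f (\<omega> (n - 1))\<close>\<close>

primrec word_map :: "(nat \<Rightarrow> 'a \<Rightarrow> 'a) \<Rightarrow> (nat \<Rightarrow> nat) \<Rightarrow> nat \<Rightarrow> 'a \<Rightarrow> 'a" where
  "word_map f \<omega> 0 = id"
| "word_map f \<omega> (Suc n) = word_map f \<omega> n \<circ> f (\<omega> n)"

definition code_map :: "(nat \<Rightarrow> 'a \<Rightarrow> 'a) \<Rightarrow> 'a set \<Rightarrow> (nat \<Rightarrow> nat) \<Rightarrow> 'a" where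
  "code_map f K \<omega> = (THE x. x \<in> (\<Inter>n. word_map f \<omega> n ` K))"

definition image_measure ::
  "nat \<Rightarrow> (nat \<Rightarrow> 'a::metric_space \<Rightarrow> 'a) \<Rightarrow> (nat \<Rightarrow> real) \<Rightarrow> real \<Rightarrow> 'a set \<Rightarrow> 'a measure" where
  "image_measure N f r \<alpha> K =
     distr (code_measure N r \<alpha>) (restrict_space borel K) (code_map f K)"


section \<open>The code measure is well defined\<close>

lemma cylinder_eq:
  "cylinder N w = code_space N \<inter> {\<omega>. \<forall>k<length w. \<omega> k = w ! k}"
  by (auto simp: cylinder_def)

lemma nat_open: "open (S :: nat set)"
  by (rule discrete_topology_class.open_discrete)

lemma code_space_borel: "code_space N \<in> sets borel"
proof -
  have "code_space N = (\<Inter>n. (\<lambda>\<omega>. \<omega> n) -` {1..N})" by (auto simp: code_space_def)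
  moreover have "closed ((\<lambda>\<omega> :: nat \<Rightarrow> nat. \<omega> n) -` {1..N})" for n
    by (rule closed_vimage[OF closed_atLeastAtMost continuous_on_product_coordinates])
  ultimately show ?thesis by (simp add: borel_closed closed_INT)
qed

lemma borel_eq_sigma_words:
  "sets (borel :: (nat \<Rightarrow> nat) measure) =
     sigma_sets UNIV (range (\<lambda>w. {\<omega>. \<forall>k<length w. \<omega> k = w ! k}))"
    (is "_ = sigma_sets UNIV (range ?C)")
proof
  have op: "open (?C w)" for w :: "nat list"
  proof -
    have "?C w = Pi\<^sub>E UNIV (\<lambda>k. if k < length w then {w ! k} else UNIV)"
      by (auto simp: PiE_iff split: if_splits)
    moreover have "open (Pi\<^sub>E UNIV (\<lambda>k. if k < length w then {w ! k} else UNIV))"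
      by (rule open_PiE) (auto simp: nat_open)
    ultimately show ?thesis by simp
  qed
  have "sigma_sets (space borel) (range ?C) \<subseteq> sets (borel :: (nat \<Rightarrow> nat) measure)"
    by (rule sets.sigma_sets_subset) (auto intro: borel_open op)
  then show "sigma_sets UNIV (range ?C) \<subseteq> sets (borel :: (nat \<Rightarrow> nat) measure)" by simp
  show "sets (borel :: (nat \<Rightarrow> nat) measure) \<subseteq> sigma_sets UNIV (range ?C)"
  proof -
    have "U \<in> sigma_sets UNIV (range ?C)" if U: "open U" for U :: "(nat \<Rightarrow> nat) set"
    proof -
      define W where "W = {w. ?C w \<subseteq> U}"
      have "\<exists>w. ?C w \<subseteq> U \<and> \<omega> \<in> ?C w" if \<omega>: "\<omega> \<in> U" for \<omega>
      proof -
        obtain X where X: "\<omega> \<in> Pi\<^sub>E UNIV X" "finite {i. X i \<noteq> UNIV}" "Pi\<^sub>E UNIV X \<subseteq> U"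
          using product_topology_open_contains_basis[of "\<lambda>_. euclidean" UNIV U \<omega>] U \<omega>
          by (auto simp: open_fun_def)
        obtain n where n: "\<And>i. X i \<noteq> UNIV \<Longrightarrow> i < n"
          using X(2) by (auto simp: finite_nat_set_iff_bounded)
        have "?C (map \<omega> [0..<n]) \<subseteq> Pi\<^sub>E UNIV X"
        proof
          fix \<eta> assume "\<eta> \<in> ?C (map \<omega> [0..<n])"
          then have eq: "\<eta> k = \<omega> k" if "k < n" for k using that by auto
          have "\<eta> k \<in> X k" for k
            using n[of k] eq[of k] X(1) by (cases "X k = UNIV") (auto simp: PiE_iff)
          then show "\<eta> \<in> Pi\<^sub>E UNIV X" by auto
        qed
        then show ?thesis using X(3) by (intro exI[of _ "map \<omega> [0..<n]"]) auto
      qed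
      then have "U = (\<Union>w\<in>W. ?C w)" by (fastforce simp: W_def)
      moreover have "(\<Union>w\<in>W. ?C w) \<in> sigma_sets UNIV (range ?C)"
        by (rule sigma_sets_UNION) auto
      ultimately show ?thesis by simp
    qed
    then have "sigma_sets UNIV {S. open S} \<subseteq> sigma_sets UNIV (range ?C)"
      by (intro sigma_sets_mono) auto
    then show ?thesis by (simp add: borel_def)
  qed
qed

lemma sets_code_space_eq:
  "sets (restrict_space borel (code_space N)) =
     sigma_sets (code_space N) (range (cylinder N))"
proof -
  have "sets (restrict_space borel (code_space N)) = (\<inter>) (code_space N) ` sets borel"
    by (simp add: sets_restrict_space)
  also have "\<dots> = sigma_sets (code_space N)
      ((\<inter>) (code_space N) ` range (\<lambda>w. {\<omega>. \<forall>k<length w. \<omega> k = w ! k}))"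
    using code_space_borel unfolding borel_eq_sigma_words by (intro sigma_sets_Int) auto
  also have "(\<inter>) (code_space N) ` range (\<lambda>w. {\<omega>. \<forall>k<length w. \<omega> k = w ! k}) = range (cylinder N)"
    unfolding image_image cylinder_eq by simp
  finally show ?thesis .
qed

lemma cylinder_empty: "w \<notin> lists {1..N} \<Longrightarrow> cylinder N w = {}"
proof -
  assume "w \<notin> lists {1..N}"
  then obtain k where k: "k < length w" "w ! k \<notin> {1..N}"
    by (auto simp: lists_eq_set subset_iff in_set_conv_nth)
  have "\<omega> \<notin> cylinder N w" for \<omega>
  proof
    assume "\<omega> \<in> cylinder N w"
    then have "\<omega> k = w ! k" "\<omega> \<in> UNIV \<rightarrow> {1..N}"
      using k(1) by (simp_all add: cylinder_def code_space_def)
    then have "\<omega> k = w ! k" "\<omega> k \<in> {1..N}" by (blast dest: Pi_mem)+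
    then show False using k(2) by simp
  qed
  then show ?thesis by blast
qed

lemma cylinder_Int: "\<exists>u. cylinder N v \<inter> cylinder N w = cylinder N u"
proof (cases "\<exists>\<eta>. \<eta> \<in> cylinder N v \<inter> cylinder N w")
  case True
  then obtain \<eta> where \<eta>: "\<eta> \<in> cylinder N v" "\<eta> \<in> cylinder N w" by blast
  then have "cylinder N v \<inter> cylinder N w =
      cylinder N (map \<eta> [0..<max (length v) (length w)])"
    by (auto simp: cylinder_def less_max_iff_disj)
  then show ?thesis by blast
next
  case False
  have "cylinder N [0] = {}" by (rule cylinder_empty) auto
  with False show ?thesis by (metis ex_in_conv)
qed

lemma code_measure_unique:
  assumes "is_code_measure N r \<alpha> \<mu>" "is_code_measure N r \<alpha> \<nu>"
  shows "\<mu> = \<nu>"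
proof (rule measure_eqI_generator_eq[where E = "range (cylinder N)" and \<Omega> = "code_space N"
      and A = "\<lambda>_. code_space N"])
  interpret M: prob_space \<mu> using assms by (simp add: is_code_measure_def)
  interpret V: prob_space \<nu> using assms by (simp add: is_code_measure_def)
  show "Int_stable (range (cylinder N))"
  proof (unfold Int_stable_def, intro ballI)
    fix a b assume "a \<in> range (cylinder N)" "b \<in> range (cylinder N)"
    then obtain v w where "a = cylinder N v" "b = cylinder N w" by blast
    then show "a \<inter> b \<in> range (cylinder N)" using cylinder_Int[of N v w] by auto
  qed
  show "range (cylinder N) \<subseteq> Pow (code_space N)" by (auto simp: cylinder_def)
  show "emeasure \<mu> X = emeasure \<nu> X" if "X \<in> range (cylinder N)" for X
  proof -
    obtain w where w: "X = cylinder N w" using \<open>X \<in> range (cylinder N)\<close> by blast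
    show ?thesis
    proof (cases "w \<in> lists {1..N}")
      case True
      then show ?thesis
        using assms by (simp add: w is_code_measure_def M.emeasure_eq_measure V.emeasure_eq_measure)
    qed (simp add: w cylinder_empty)
  qed
  show "sets \<mu> = sigma_sets (code_space N) (range (cylinder N))"
    "sets \<nu> = sigma_sets (code_space N) (range (cylinder N))"
    using assms by (simp_all add: is_code_measure_def sets_code_space_eq)
  have "cylinder N [] = code_space N" by (simp add: cylinder_def)
  then show "range (\<lambda>_::nat. code_space N) \<subseteq> range (cylinder N)" by (metis image_subsetI rangeI)
  show "(\<Union>_::nat. code_space N) = code_space N" by simp
  show "emeasure \<mu> (code_space N) \<noteq> \<infinity>" for i :: nat by simp
qed

lemma code_measure_exists:
  assumes r: "\<And>i. i \<in> {1..N} \<Longrightarrow> 0 < r i" and \<alpha>: "similarity_dimension N r \<alpha>"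
  shows "\<exists>\<nu>. is_code_measure N r \<alpha> \<nu>"
proof -
  define q where "q i = (if i \<in> {1..N} then r i powr \<alpha> else 0)" for i
  have q0: "0 \<le> q i" for i by (simp add: q_def)
  have q1: "(\<integral>\<^sup>+i. ennreal (q i) \<partial>count_space UNIV) = 1"
  proof -
    have "(\<integral>\<^sup>+i. ennreal (q i) \<partial>count_space UNIV) = (\<Sum>i\<in>{1..N}. ennreal (q i))"
      by (rule nn_integral_count_space') (auto simp: q_def)
    also have "\<dots> = ennreal (\<Sum>i\<in>{1..N}. q i)" using q0 by (intro sum_ennreal)
    also have "(\<Sum>i\<in>{1..N}. q i) = (\<Sum>i=1..N. r i powr \<alpha>)"
      by (intro sum.cong) (auto simp: q_def)
    finally show ?thesis using \<alpha> by (simp add: similarity_dimension_def)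
  qed
  define p where "p = embed_pmf q"
  have pq: "pmf p i = q i" for i unfolding p_def by (rule pmf_embed_pmf[OF q0 q1])
  define P where "P = PiM (UNIV :: nat set) (\<lambda>_. measure_pmf p)"
  interpret P: product_prob_space "\<lambda>_::nat. measure_pmf p" UNIV
    by (rule product_prob_spaceI) (rule prob_space_measure_pmf)
  have setsP: "sets P = sets borel"
  proof -
    have "sets P = sets (PiM (UNIV :: nat set) (\<lambda>_. borel :: nat measure))"
      unfolding P_def by (rule sets_PiM_cong) (auto simp: sets_borel_eq_count_space)
    then show ?thesis by (simp add: sets_PiM_equal_borel)
  qed
  then have spaceP: "space P = UNIV" by (metis sets_eq_imp_space_eq space_borel)
  have PP: "prob_space P" unfolding P_def by (rule P.prob_space_axioms)
  interpret PP: prob_space P by (rule PP)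
  have code: "code_space N \<in> sets P" by (simp add: setsP code_space_borel)
  have "AE \<omega> in P. \<forall>n. \<omega> n \<in> {1..N}"
  proof (rule AE_all_countable[THEN iffD2], rule allI)
    fix n :: nat
    have "AE i in measure_pmf p. i \<in> {1..N}"
      by (auto simp: AE_measure_pmf_iff set_pmf_iff pq q_def split: if_splits)
    then show "AE \<omega> in P. \<omega> n \<in> {1..N}" unfolding P_def by (intro P.AE_component) auto
  qed
  then have AE: "AE \<omega> in P. \<omega> \<in> code_space N" by (simp add: code_space_def Pi_iff)
  have meas: "measure P (cylinder N w) = (\<Prod>i\<leftarrow>w. r i) powr \<alpha>" if w: "w \<in> lists {1..N}" for w
  proof -
    let ?C = "{\<omega>. \<forall>k<length w. \<omega> k = w ! k}"
    have C: "?C = prod_emb UNIV (\<lambda>_. measure_pmf p) {..<length w} (Pi\<^sub>E {..<length w} (\<lambda>k. {w ! k}))"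
      by (simp add: prod_emb_def PiE_def Pi_def vimage_def Int_def)
    have Cs: "?C \<in> sets P"
      unfolding setsP borel_eq_sigma_words by (intro sigma_sets.Basic) auto
    have "measure P (cylinder N w) = measure P ?C"
      using AE Cs code by (intro PP.finite_measure_eq_AE) (auto simp: cylinder_eq)
    also have "\<dots> = (\<Prod>k<length w. measure (measure_pmf p) {w ! k})"
      unfolding C P_def by (rule P.measure_PiM_emb) auto
    also have "\<dots> = (\<Prod>k<length w. r (w ! k) powr \<alpha>)"
    proof (rule prod.cong)
      fix k assume "k \<in> {..<length w}"
      then have "w ! k \<in> {1..N}" using w by (metis in_listsD lessThan_iff nth_mem)
      then show "measure (measure_pmf p) {w ! k} = r (w ! k) powr \<alpha>"
        by (simp add: measure_pmf_single pq q_def)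
    qed simp
    also have "\<dots> = (\<Prod>i\<leftarrow>w. r i powr \<alpha>)"
      by (simp add: prod.list_conv_set_nth atLeast0LessThan)
    also have "\<dots> = (\<Prod>i\<leftarrow>w. r i) powr \<alpha>"
    proof -
      have "0 \<le> (\<Prod>i\<leftarrow>w. r i) \<and> (\<Prod>i\<leftarrow>w. r i powr \<alpha>) = (\<Prod>i\<leftarrow>w. r i) powr \<alpha>"
        using w by (induction w) (auto simp: powr_mult less_imp_le[OF r])
      then show ?thesis ..
    qed
    finally show ?thesis .
  qed
  let ?\<nu> = "restrict_space P (code_space N)"
  have "prob_space ?\<nu>"
  proof (rule prob_spaceI)
    have "emeasure P (code_space N) = 1"
      using AE code PP.emeasure_eq_1_AE by blast
    then show "emeasure ?\<nu> (space ?\<nu>) = 1"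
      using code by (simp add: space_restrict_space spaceP emeasure_restrict_space)
  qed
  moreover have "sets ?\<nu> = sets (restrict_space borel (code_space N))"
    by (simp add: sets_restrict_space setsP)
  moreover have "measure ?\<nu> (cylinder N w) = measure P (cylinder N w)" for w
    using code by (intro measure_restrict_space) (auto simp: spaceP cylinder_def)
  ultimately show ?thesis using meas unfolding is_code_measure_def by (intro exI[of _ ?\<nu>]) simp
qed

lemma is_code_measure_code_measure:
  assumes "\<And>i. i \<in> {1..N} \<Longrightarrow> 0 < r i" and "similarity_dimension N r \<alpha>"
  shows "is_code_measure N r \<alpha> (code_measure N r \<alpha>)"
proof -
  obtain \<nu> where \<nu>: "is_code_measure N r \<alpha> \<nu>" using code_measure_exists[OF assms] by blast
  show ?thesis
    unfolding code_measure_def by (rule theI[where P = "is_code_measure N r \<alpha>"], rule \<nu>) (rule code_measure_unique[OF _ \<nu>])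
qed

end

theory Submission
  imports Defs
begin

text \<open>
  If \<open>U \<noteq> {}\<close>, then \<open>V = U\<close> witnesses the strong open set condition. Given a set \<open>V\<close> as in that
  condition, fix a word \<open>w\<close> with \<open>f\<^sub>w(K) \<subseteq> V\<close>; the maps \<open>f\<^sub>v \<circ> f\<^sub>w\<close>, \<open>v\<close> ranging over the words of length
  \<open>n\<close>, have disjoint images of \<open>K\<close>, so the mass distribution principle gives
  \<open>dim K \<ge> s\<close> as soon as \<open>\<Sum>\<^sub>v (r\<^sub>v r\<^sub>w)\<^sup>s \<ge> 1\<close>, and for \<open>s < \<alpha>\<close> this holds for large \<open>n\<close>. Conversely, if
  \<open>B\<close> has interior, then \<open>f\<^sub>j f\<^sub>w(K) \<subseteq> f\<^sub>k(K)\<close> for some word \<open>w\<close> and some \<open>j \<noteq> k\<close>; dropping the word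
  \<open>jw\<close> leaves a system that still covers \<open>K\<close> but has smaller similarity dimension.

  For the measure conditions, inverse invariance says that the shift maps the set of codes of points of \<open>B\<close>
  into itself; when \<open>U \<noteq> {}\<close> this set misses a cylinder, hence is null.
\<close>

section \<open>Words of a system of similitudes\<close>

text \<open>A word \<open>w = [i\<^sub>1, \<dots>, i\<^sub>n]\<close> acts by \<open>foldr f w = f i\<^sub>1 \<circ> \<dots> \<circ> f i\<^sub>n\<close>.\<close>

definition words :: "'i set \<Rightarrow> nat \<Rightarrow> 'i list set" where
  "words I n = {w \<in> lists I. length w = n}"

lemma words_0 [simp]: "words I 0 = {[]}"
  by (auto simp: words_def)

lemma words_Suc: "words I (Suc n) = (\<lambda>(i, w). i # w) ` (I \<times> words I n)"
  by (auto simp: words_def length_Suc_conv image_iff)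

lemma finite_words [simp]: "finite I \<Longrightarrow> finite (words I n)"
  by (induction n) (auto simp: words_Suc)

text \<open>Multiplying out the \<open>n\<close>-th power of a sum yields one monomial for each word
  of length \<open>n\<close>.\<close>

lemma sum_words_prod:
  fixes p :: "'i \<Rightarrow> 'b::comm_semiring_1"
  assumes "finite I"
  shows "(\<Sum>w\<in>words I n. \<Prod>i\<leftarrow>w. p i) = (\<Sum>i\<in>I. p i) ^ n"
proof (induction n)
  case (Suc n)
  have "(\<Sum>w\<in>words I (Suc n). \<Prod>i\<leftarrow>w. p i) = (\<Sum>(i, w)\<in>I \<times> words I n. p i * (\<Prod>i\<leftarrow>w. p i))"
    unfolding words_Suc by (subst sum.reindex) (auto simp: inj_on_def case_prod_unfold)
  also have "\<dots> = (\<Sum>i\<in>I. p i) * (\<Sum>w\<in>words I n. \<Prod>i\<leftarrow>w. p i)"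
    by (simp add: sum_product sum.cartesian_product)
  finally show ?case by (simp add: Suc)
qed simp

text \<open>The index type is arbitrary because the locale is later interpreted with finite sets of
  words as indices, each word acting as a single similitude.\<close>

locale similitudes =
  fixes I :: "'i set" and f :: "'i \<Rightarrow> 'a::metric_space \<Rightarrow> 'a" and r :: "'i \<Rightarrow> real"
  assumes finite_I [simp]: "finite I"
    and similitude: "i \<in> I \<Longrightarrow> contracting_similitude (r i) (f i)"
begin

abbreviation ratio :: "'i list \<Rightarrow> real" where
  "ratio w \<equiv> (\<Prod>i\<leftarrow>w. r i)"

lemma r_pos: "i \<in> I \<Longrightarrow> 0 < r i" and r_less_1: "i \<in> I \<Longrightarrow> r i < 1"
  and dist_f: "i \<in> I \<Longrightarrow> dist (f i x) (f i y) = r i * dist x y"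
  using similitude by (auto simp: contracting_similitude_def)

lemma ratio_pos: "w \<in> lists I \<Longrightarrow> 0 < ratio w"
  by (induction w) (auto intro: r_pos mult_pos_pos)

lemma ratio_powr: "w \<in> lists I \<Longrightarrow> ratio w powr s = (\<Prod>i\<leftarrow>w. r i powr s)"
  by (induction w) (auto simp: powr_mult r_pos less_imp_le ratio_pos)

lemma sum_ratio_powr: "(\<Sum>w\<in>words I n. ratio w powr s) = (\<Sum>i\<in>I. r i powr s) ^ n"
  by (subst sum_words_prod[symmetric]) (auto intro!: sum.cong simp: ratio_powr words_def)

lemma ratio_less_1: "w \<in> lists I \<Longrightarrow> w \<noteq> [] \<Longrightarrow> ratio w < 1"
proof (induction w)
  case (Cons i w)
  have "ratio w \<le> 1" using Cons by (cases w) (auto intro: less_imp_le)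
  then have "r i * ratio w \<le> r i" using Cons r_pos[of i] by (simp add: mult_left_le)
  then show ?case using Cons r_less_1[of i] by simp
qed simp

lemma dist_word:
  "w \<in> lists I \<Longrightarrow> dist (foldr f w x) (foldr f w y) = ratio w * dist x y"
  by (induction w) (auto simp: dist_f)

lemma similitude_word: "w \<in> lists I \<Longrightarrow> w \<noteq> [] \<Longrightarrow> contracting_similitude (ratio w) (foldr f w)"
  by (simp add: contracting_similitude_def ratio_pos ratio_less_1 dist_word)

lemma word_eq_iff: "w \<in> lists I \<Longrightarrow> foldr f w x = foldr f w y \<longleftrightarrow> x = y"
  using dist_word[of w x y] ratio_pos[of w] by (metis dist_eq_0_iff mult_eq_0_iff less_irrefl)

lemma inj_word: "w \<in> lists I \<Longrightarrow> inj (foldr f w)"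
  by (rule injI) (simp add: word_eq_iff)

lemma inj_f: "i \<in> I \<Longrightarrow> inj (f i)"
  using inj_word[of "[i]"] by simp

lemma continuous_on_word: "w \<in> lists I \<Longrightarrow> continuous_on S (foldr f w)"
  unfolding continuous_on_iff
proof (intro ballI allI impI)
  fix x e assume w: "w \<in> lists I" and "x \<in> S" "(0::real) < e"
  then show "\<exists>d>0. \<forall>x'\<in>S. dist x' x < d \<longrightarrow> dist (foldr f w x') (foldr f w x) < e"
    using ratio_pos[OF w]
    by (intro exI[of _ "e / ratio w"]) (auto simp: dist_word field_simps)
qed

lemma continuous_on_f: "i \<in> I \<Longrightarrow> continuous_on S (f i)"
  using continuous_on_word[of "[i]"] by simp

text \<open>Inserting 0 keeps the maximum meaningful for an empty \<open>I\<close>;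
  \<open>rmax\<close> serves as a uniform contraction factor below 1.\<close>

definition rmax :: real where
  "rmax = Max (insert 0 (r ` I))"

lemma rmax_nonneg: "0 \<le> rmax" and rmax_less_1: "rmax < 1" and r_le_rmax: "i \<in> I \<Longrightarrow> r i \<le> rmax"
  using r_less_1 by (auto simp: rmax_def)

lemma ratio_le: "w \<in> lists I \<Longrightarrow> ratio w \<le> rmax ^ length w"
  by (induction w) (auto intro!: mult_mono simp: r_le_rmax rmax_nonneg ratio_pos less_imp_le in_lists_conv_set)

lemma rmax_power_tendsto: "(\<lambda>n. rmax ^ n * c) \<longlonglongrightarrow> 0"
  using tendsto_mult_left_zero[OF LIMSEQ_power_zero[of rmax]] rmax_nonneg rmax_less_1 by simp

lemma word_subset:
  assumes "\<And>i. i \<in> I \<Longrightarrow> f i ` K \<subseteq> K" "w \<in> lists I"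
  shows "foldr f w ` K \<subseteq> K"
  using assms(2) by (induction w) (use assms(1) in auto)

lemma diameter_word:
  assumes "bounded K" "w \<in> lists I"
  shows "bounded (foldr f w ` K)" "diameter (foldr f w ` K) \<le> ratio w * diameter K"
proof -
  have *: "dist (foldr f w x) (foldr f w y) \<le> ratio w * diameter K" if "x \<in> K" "y \<in> K" for x y
    using that assms ratio_pos[of w] by (simp add: dist_word diameter_bounded_bound)
  then show "bounded (foldr f w ` K)"
    unfolding bounded_two_points by blast
  show "diameter (foldr f w ` K) \<le> ratio w * diameter K"
    using * by (cases "K = {}") (auto simp: diameter_def intro!: cSUP_least)
qed

lemma cover_words:
  assumes "K \<subseteq> (\<Union>i\<in>I. f i ` K)"
  shows "K \<subseteq> (\<Union>w\<in>words I n. foldr f w ` K)"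
proof (induction n)
  case (Suc n)
  show ?case
  proof
    fix x assume "x \<in> K"
    then obtain i y where i: "i \<in> I" "y \<in> K" "x = f i y" using assms by blast
    then obtain w z where "w \<in> words I n" "z \<in> K" "y = foldr f w z" using Suc by blast
    then show "x \<in> (\<Union>w\<in>words I (Suc n). foldr f w ` K)"
      using i by (auto simp: words_Suc intro!: bexI[of _ "(i, w)"] imageI)
  qed
qed simp

text \<open>Each point of \<open>V\<close> lies in the image of \<open>K\<close> under some word of
  any prescribed length. Such an image has diameter at most \<open>rmax ^ n * diameter K\<close>, so
  for large \<open>n\<close> it stays in a ball whose trace on \<open>K\<close> is inside
  \<open>V\<close>.\<close>

lemma word_in_open:
  assumes "bounded K" "K \<subseteq> (\<Union>i\<in>I. f i ` K)" "\<And>i. i \<in> I \<Longrightarrow> f i ` K \<subseteq> K"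
    and V: "openin (top_of_set K) V" "V \<noteq> {}"
  obtains w where "w \<in> lists I" "foldr f w ` K \<subseteq> V"
proof -
  obtain x where x: "x \<in> V" using V by blast
  then have xK: "x \<in> K" using V openin_imp_subset by blast
  obtain e where e: "e > 0" "ball x e \<inter> K \<subseteq> V"
    using V(1) x by (auto simp: openin_contains_ball)
  have "eventually (\<lambda>n. rmax ^ n * diameter K < e) sequentially"
    using order_tendstoD(2)[OF rmax_power_tendsto e(1)] .
  then obtain n where n: "rmax ^ n * diameter K < e" by (auto simp: eventually_sequentially)
  obtain w where w: "w \<in> words I n" "x \<in> foldr f w ` K" using cover_words[OF assms(2)] xK by blast
  then have w': "w \<in> lists I" "length w = n" by (auto simp: words_def)
  have "foldr f w ` K \<subseteq> ball x e"
  proof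
    fix y assume "y \<in> foldr f w ` K"
    then have "dist x y \<le> diameter (foldr f w ` K)"
      using w diameter_word[OF assms(1) w'(1)] by (auto intro!: diameter_bounded_bound)
    also have "\<dots> \<le> ratio w * diameter K" by (rule diameter_word[OF assms(1) w'(1)])
    also have "\<dots> \<le> rmax ^ n * diameter K"
      using ratio_le[OF w'(1)] w'(2) diameter_ge_0[OF assms(1)] by (auto intro: mult_right_mono)
    finally show "y \<in> ball x e" using n by simp
  qed
  moreover have "foldr f w ` K \<subseteq> K" using w' assms(3) by (intro word_subset)
  ultimately show ?thesis using that[OF w'(1)] e(2) by blast
qed

end


section \<open>Bounds for the Hausdorff dimension\<close>

text \<open>The finite cover is padded to a sequence by empty sets, whose weight and diameter are 0;
  hence the requirement \<open>0 \<le> \<delta>\<close>.\<close>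

lemma hausdorff_measure_at_finite_cover:
  assumes "finite C" "A \<subseteq> \<Union>C" "0 \<le> \<delta>" "\<And>E. E \<in> C \<Longrightarrow> bounded E \<and> diameter E \<le> \<delta>"
  shows "hausdorff_measure_at \<delta> s A \<le> (\<Sum>E\<in>C. diam_weight s E)"
proof -
  obtain h where h: "bij_betw h {..<card C} C"
    using ex_bij_betw_nat_finite[OF assms(1)] by (auto simp: atLeast0LessThan)
  define E where "E n = (if n < card C then h n else {})" for n
  have hC: "h n \<in> C" if "n < card C" for n using h that by (auto simp: bij_betw_def)
  note assms(2)
  also have "\<Union>C = (\<Union>n<card C. h n)" using h by (simp add: bij_betw_def)
  also have "\<dots> \<subseteq> (\<Union>n. E n)" by (rule UN_mono) (auto simp: E_def)
  finally have "A \<subseteq> (\<Union>n. E n)" .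
  moreover have "bounded (E n) \<and> diameter (E n) \<le> \<delta>" for n
    using assms(3,4) hC[of n] by (simp add: E_def)
  ultimately have "hausdorff_measure_at \<delta> s A \<le> (\<Sum>n. diam_weight s (E n))"
    unfolding hausdorff_measure_at_def by (intro INF_lower) simp
  also have "\<dots> = (\<Sum>n<card C. diam_weight s (E n))"
    by (rule suminf_finite) (auto simp: E_def diam_weight_def)
  also have "\<dots> = (\<Sum>n<card C. diam_weight s (h n))" by (simp add: E_def)
  also have "\<dots> = (\<Sum>E\<in>C. diam_weight s E)" by (rule sum.reindex_bij_betw[OF h])
  finally show ?thesis .
qed

lemma hausdorff_measure_at_antimono:
  "\<delta> \<le> \<delta>' \<Longrightarrow> hausdorff_measure_at \<delta>' s A \<le> hausdorff_measure_at \<delta> s A"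
  unfolding hausdorff_measure_at_def by (rule INF_superset_mono) (auto intro: order_trans)

lemma hausdorff_dim_le: "0 \<le> s \<Longrightarrow> hausdorff_measure s A = 0 \<Longrightarrow> hausdorff_dim A \<le> ereal s"
  unfolding hausdorff_dim_def by (rule Inf_lower) auto

text \<open>The mass distribution argument below treats positive exponents. At exponent 0 every
  nonempty member of a cover has weight 1, and a cover of a nonempty set has such a member.\<close>

lemma hausdorff_measure_0:
  assumes "A \<noteq> {}"
  shows "hausdorff_measure 0 A \<noteq> 0"
proof -
  have "1 \<le> hausdorff_measure_at 1 0 A"
    unfolding hausdorff_measure_at_def
  proof (rule INF_greatest, clarify)
    fix E :: "nat \<Rightarrow> 'a set" assume "A \<subseteq> (\<Union>n. E n)"
    then obtain n where n: "E n \<noteq> {}" using assms by blast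
    have "1 = (\<Sum>m\<in>{n}. diam_weight 0 (E m))" using n by (simp add: diam_weight_def)
    also have "\<dots> \<le> (\<Sum>m. diam_weight 0 (E m))" by (intro sum_le_suminf) auto
    finally show "1 \<le> (\<Sum>m. diam_weight 0 (E m))" .
  qed
  also have "\<dots> \<le> hausdorff_measure 0 A"
    unfolding hausdorff_measure_def by (rule SUP_upper) simp
  finally show ?thesis by auto
qed

text \<open>The word images of length \<open>n\<close> cover \<open>K\<close>, and their weights add
  up to at most the \<open>n\<close>-th power of the given sum times
  \<open>diameter K powr s\<close>, which tends to 0. This is applied to the full system above the
  similarity dimension and to a system with one word deleted below it.\<close>

lemma (in similitudes) hausdorff_measure_eq_0:
  assumes K: "bounded K" "K \<subseteq> (\<Union>i\<in>I. f i ` K)" and s: "0 < s" "(\<Sum>i\<in>I. r i powr s) < 1"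
  shows "hausdorff_measure s K = 0"
proof -
  define q where "q = (\<Sum>i\<in>I. r i powr s)"
  have q: "0 \<le> q" "q < 1" using s by (auto simp: q_def intro: sum_nonneg)
  define D where "D = diameter K"
  have D: "0 \<le> D" using K by (simp add: D_def diameter_ge_0)
  have bound: "hausdorff_measure_at (rmax ^ n * D) s K \<le> ennreal (q ^ n * D powr s)" for n
  proof -
    have *: "bounded (foldr f w ` K)" "diameter (foldr f w ` K) \<le> ratio w * D"
       "w \<in> lists I" "length w = n"
      if "w \<in> words I n" for w
      using that diameter_word[OF K(1), of w] by (auto simp: words_def D_def)
    have "hausdorff_measure_at (rmax ^ n * D) s K \<le>
        (\<Sum>E\<in>(\<lambda>w. foldr f w ` K) ` words I n. diam_weight s E)"
    proof (rule hausdorff_measure_at_finite_cover)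
      show "K \<subseteq> \<Union> ((\<lambda>w. foldr f w ` K) ` words I n)" by (rule cover_words[OF K(2)])
      fix E assume "E \<in> (\<lambda>w. foldr f w ` K) ` words I n"
      then obtain w where w: "w \<in> words I n" "E = foldr f w ` K" by blast
      have "ratio w * D \<le> rmax ^ n * D" using ratio_le[of w] *[OF w(1)] D by (auto intro: mult_right_mono)
      then show "bounded E \<and> diameter E \<le> rmax ^ n * D" using *[OF w(1)] w(2) by auto
    qed (use D rmax_nonneg in auto)
    \<comment> \<open>Different words may have the same image, so summing over words instead of
      images can only increase the total.\<close>
    also have "\<dots> \<le> (\<Sum>w\<in>words I n. diam_weight s (foldr f w ` K))"
      by (rule sum_image_le[unfolded o_def]) auto
    also have "\<dots> \<le> (\<Sum>w\<in>words I n. ennreal (ratio w powr s * D powr s))"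
    proof (rule sum_mono)
      fix w assume w: "w \<in> words I n"
      have "diameter (foldr f w ` K) powr s \<le> (ratio w * D) powr s"
        using *[OF w] s by (intro powr_mono2) (auto simp: diameter_ge_0)
      also have "\<dots> = ratio w powr s * D powr s" using *[OF w] ratio_pos[of w] D by (simp add: powr_mult)
      finally show "diam_weight s (foldr f w ` K) \<le> ennreal (ratio w powr s * D powr s)"
        using s by (auto simp: diam_weight_def intro: ennreal_leI)
    qed
    also have "\<dots> = ennreal (\<Sum>w\<in>words I n. ratio w powr s * D powr s)"
      by (rule sum_ennreal) auto
    also have "(\<Sum>w\<in>words I n. ratio w powr s * D powr s) = q ^ n * D powr s"
      by (simp add: sum_distrib_right[symmetric] sum_ratio_powr q_def)
    finally show ?thesis .
  qed
  have lim: "(\<lambda>n. ennreal (q ^ n * D powr s)) \<longlonglongrightarrow> 0"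
    using tendsto_ennrealI[OF tendsto_mult_left_zero[OF LIMSEQ_power_zero[of q], of "D powr s"]] q
    by simp
  have "hausdorff_measure_at \<delta> s K = 0" if \<delta>: "0 < \<delta>" for \<delta>
  proof -
    have "eventually (\<lambda>n. rmax ^ n * D < \<delta>) sequentially"
      using order_tendstoD(2)[OF rmax_power_tendsto \<delta>] .
    \<comment> \<open>Enlarging the mesh only lowers the value, so the bound at mesh
      \<open>rmax ^ n * D\<close> carries over to \<open>\<delta>\<close> once \<open>n\<close> is
      large.\<close>
    then have "eventually (\<lambda>n. hausdorff_measure_at \<delta> s K \<le> ennreal (q ^ n * D powr s)) sequentially"
      by eventually_elim (meson bound hausdorff_measure_at_antimono less_imp_le order_trans)
    then have "hausdorff_measure_at \<delta> s K \<le> 0"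
      by (intro tendsto_lowerbound[OF lim]) auto
    then show ?thesis by simp
  qed
  then show ?thesis by (simp add: hausdorff_measure_def)
qed

section \<open>The code measure and the code map\<close>

abbreviation (input) shift :: "nat \<Rightarrow> (nat \<Rightarrow> 'b) \<Rightarrow> nat \<Rightarrow> 'b" where
  "shift n \<omega> \<equiv> (\<lambda>k. \<omega> (n + k))"

lemma code_space_iff: "\<omega> \<in> code_space N \<longleftrightarrow> (\<forall>k. \<omega> k \<in> {1..N})"
  by (simp add: code_space_def Pi_iff)

lemma prefix_in_lists: "\<omega> \<in> code_space N \<Longrightarrow> map \<omega> [0..<n] \<in> lists {1..N}"
  by (auto simp: code_space_iff)

lemma cylinder_iff: "\<omega> \<in> cylinder N w \<longleftrightarrow> \<omega> \<in> code_space N \<and> map \<omega> [0..<length w] = w"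
proof -
  have "map \<omega> [0..<length w] = w \<longleftrightarrow> (\<forall>k<length w. \<omega> k = w ! k)"
    by (subst list_eq_iff_nth_eq) simp
  then show ?thesis by (simp add: cylinder_def)
qed

lemma prefix_add: "map \<omega> [0..<m + n] = map \<omega> [0..<m] @ map (shift m \<omega>) [0..<n]"
  by (induction n) simp_all

lemma shift_in_code_space: "\<omega> \<in> code_space N \<Longrightarrow> shift n \<omega> \<in> code_space N"
  by (simp add: code_space_iff)

lemma cylinder_append:
  "w \<in> lists {1..N} \<Longrightarrow> cylinder N (w @ v) = cylinder N w \<inter> {\<omega>. shift (length w) \<omega> \<in> cylinder N v}"
  by (auto simp: cylinder_iff prefix_add shift_in_code_space)

lemma word_map_eq_foldr: "word_map f \<omega> n = foldr f (map \<omega> [0..<n])"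
  by (induction n) (auto simp: fun_eq_iff)

text \<open>Weights and exponent are parameters because two instances occur: ratios \<open>r\<close>
  with exponent \<open>\<alpha>\<close> for the image measure, and normalised weights with exponent
  1 for the mass distribution.\<close>

locale bernoulli =
  fixes N :: nat and p :: "nat \<Rightarrow> real" and \<beta> :: real and \<nu> :: "(nat \<Rightarrow> nat) measure"
  assumes code_measure: "is_code_measure N p \<beta> \<nu>"
    and p_pos: "i \<in> {1..N} \<Longrightarrow> 0 < p i"
begin

sublocale prob_space \<nu>
  using code_measure by (simp add: is_code_measure_def)

lemma sets_eq: "sets \<nu> = sets (restrict_space borel (code_space N))"
  using code_measure by (simp add: is_code_measure_def)

lemma space_eq [simp]: "space \<nu> = code_space N"
  using sets_eq_imp_space_eq[OF sets_eq] by (simp add: space_restrict_space)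

lemma cylinder_sets [simp, intro]: "cylinder N w \<in> sets \<nu>"
  by (auto simp: sets_eq sets_code_space_eq)

lemma prob_cylinder: "w \<in> lists {1..N} \<Longrightarrow> prob (cylinder N w) = (\<Prod>i\<leftarrow>w. p i) powr \<beta>"
  using code_measure by (simp add: is_code_measure_def)

lemma prob_cylinder_pos: "w \<in> lists {1..N} \<Longrightarrow> 0 < prob (cylinder N w)"
proof -
  assume w: "w \<in> lists {1..N}"
  then have "0 < (\<Prod>i\<leftarrow>w. p i)" by (induction w) (auto simp: p_pos)
  then show ?thesis using w by (simp add: prob_cylinder)
qed

lemma prefix_measurable: "(\<lambda>\<omega>. map \<omega> [0..<n]) \<in> measurable \<nu> (count_space UNIV)"
proof (unfold measurable_count_space_eq2_countable, intro conjI ballI)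
  fix w :: "nat list"
  have "(\<lambda>\<omega>. map \<omega> [0..<n]) -` {w} \<inter> space \<nu> = (if length w = n then cylinder N w else {})"
    by (auto simp: cylinder_iff)
  then show "(\<lambda>\<omega>. map \<omega> [0..<n]) -` {w} \<inter> space \<nu> \<in> sets \<nu>" by simp
qed simp

text \<open>Cylinders generate the events, so only their preimages have to be checked.\<close>

lemma measurable_code_spaceI:
  assumes "\<And>\<omega>. \<omega> \<in> space M \<Longrightarrow> g \<omega> \<in> code_space N"
    and "\<And>w. {\<omega> \<in> space M. g \<omega> \<in> cylinder N w} \<in> sets M"
  shows "g \<in> measurable M \<nu>"
proof (rule measurable_sigma_sets)
  show "sets \<nu> = sigma_sets (code_space N) (range (cylinder N))"
    by (simp add: sets_eq sets_code_space_eq)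
  show "range (cylinder N) \<subseteq> Pow (code_space N)" by (auto simp: cylinder_def)
  fix y assume "y \<in> range (cylinder N)"
  then obtain w where w: "y = cylinder N w" by blast
  have "g -` y \<inter> space M = {\<omega> \<in> space M. g \<omega> \<in> cylinder N w}" by (auto simp: w)
  then show "g -` y \<inter> space M \<in> sets M" using assms(2) by simp
qed (use assms(1) in auto)

text \<open>The first \<open>n\<close> symbols are free, so the preimage of a cylinder under the
  shift is a finite union of cylinders; this makes the shift measurable.\<close>

lemma shift_cylinder: 
  "{\<omega> \<in> code_space N. shift n \<omega> \<in> cylinder N w} = 
    (\<Union>v\<in>words {1..N} n. cylinder N (v @ w))" (is "?A = ?B")
proof (intro equalityI subsetI)
  fix \<omega> assume \<omega>: "\<omega> \<in> ?A"
  have "map \<omega> [0..<n] \<in> words {1..N} n" using \<omega> prefix_in_lists[of \<omega> N n] by (simp add: words_def)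
  moreover have "\<omega> \<in> cylinder N (map \<omega> [0..<n] @ w)" using \<omega> by (simp add: cylinder_iff prefix_add)
  ultimately show "\<omega> \<in> ?B" by blast
next
  fix \<omega> assume "\<omega> \<in> ?B"
  then show "\<omega> \<in> ?A" by (auto simp: words_def cylinder_iff prefix_add shift_in_code_space)
qed

lemma shift_measurable: "shift n \<in> measurable \<nu> \<nu>"
  by (rule measurable_code_spaceI) (auto simp: shift_in_code_space shift_cylinder)

text \<open>Conditioning on a cylinder and shifting gives a measure with the same cylinder weights,
  hence the code measure itself.\<close>

lemma prob_cylinder_shift:
  assumes w: "w \<in> lists {1..N}" and A: "A \<in> events"
  shows "prob (cylinder N w \<inter> {\<omega>. shift (length w) \<omega> \<in> A}) = prob (cylinder N w) * prob A"
proof -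
  let ?C = "cylinder N w" and ?s = "shift (length w)"
  let ?U = "uniform_measure \<nu> ?C"
  let ?D = "distr ?U \<nu> ?s"
  have C: "emeasure \<nu> ?C \<noteq> 0" "emeasure \<nu> ?C \<noteq> \<infinity>" "0 < prob ?C"
    using prob_cylinder_pos[OF w] by (auto simp: emeasure_eq_measure)
  interpret U: prob_space ?U by (rule prob_space_uniform_measure[OF C(1,2)])
  have meas: "?s \<in> measurable ?U \<nu>" using shift_measurable by simp
  have D: "measure ?D S = prob (?C \<inter> {\<omega>. ?s \<omega> \<in> S}) / prob ?C" if S: "S \<in> events" for S
  proof -
    have "?s -` S \<inter> space \<nu> \<in> events" using shift_measurable S by (rule measurable_sets)
    then have "measure ?D S = prob (?C \<inter> (?s -` S \<inter> space \<nu>)) / prob ?C"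
      using meas S C by (subst measure_distr) (simp_all add: measure_uniform_measure)
    also have "?C \<inter> (?s -` S \<inter> space \<nu>) = ?C \<inter> {\<omega>. ?s \<omega> \<in> S}" by (auto simp: cylinder_iff)
    finally show ?thesis .
  qed
  have "is_code_measure N p \<beta> ?D"
    unfolding is_code_measure_def
  proof (intro conjI ballI)
    show "prob_space ?D" by (rule U.prob_space_distr[OF meas])
    show "sets ?D = sets (restrict_space borel (code_space N))" by (simp add: sets_eq)
    fix v assume v: "v \<in> lists {1..N}"
    have pos: "0 < (\<Prod>i\<leftarrow>u. p i)" if "u \<in> lists {1..N}" for u
      using that by (induction u) (auto simp: p_pos)
    have "measure ?D (cylinder N v) = prob (cylinder N (w @ v)) / prob ?C"
      using w by (subst D) (simp_all add: cylinder_append)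
    also have "\<dots> = (\<Prod>i\<leftarrow>v. p i) powr \<beta>"
      using v w pos[OF v] pos[OF w] by (simp add: prob_cylinder powr_mult)
    finally show "measure ?D (cylinder N v) = (\<Prod>i\<leftarrow>v. p i) powr \<beta>" .
  qed
  then have "?D = \<nu>" by (rule code_measure_unique[OF _ code_measure])
  then show ?thesis using D[OF A] C(3) by (simp add: field_simps)
qed

end

text \<open>The assumption is only that each map sends \<open>K\<close> into itself, so that systems
  such as \<open>foldr f (v @ w)\<close> with fixed \<open>w\<close> are included, whose images need
  not cover \<open>K\<close>.\<close>

locale code_system = similitudes "{1..N}" f r
  for N :: nat and f :: "nat \<Rightarrow> 'a::metric_space \<Rightarrow> 'a" and r :: "nat \<Rightarrow> real" +
  fixes K :: "'a set"
  assumes compact_K: "compact K" and K_nonempty: "K \<noteq> {}"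
    and f_K: "i \<in> {1..N} \<Longrightarrow> f i ` K \<subseteq> K"
begin

lemma bounded_K: "bounded K"
  by (rule compact_imp_bounded[OF compact_K])

lemma compact_word: "w \<in> lists {1..N} \<Longrightarrow> compact (foldr f w ` K)"
  by (intro compact_continuous_image continuous_on_word compact_K)

lemma foldr_f_K: "w \<in> lists {1..N} \<Longrightarrow> foldr f w ` K \<subseteq> K"
  by (rule word_subset) (rule f_K)

lemma prefix_antimono:
  assumes \<omega>: "\<omega> \<in> code_space N" and "m \<le> n"
  shows "foldr f (map \<omega> [0..<n]) ` K \<subseteq> foldr f (map \<omega> [0..<m]) ` K"
proof -
  obtain k where "n = m + k" using \<open>m \<le> n\<close> le_Suc_ex by blast
  moreover have "foldr f (map (shift m \<omega>) [0..<k]) ` K \<subseteq> K"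
    by (rule foldr_f_K[OF prefix_in_lists[OF shift_in_code_space[OF \<omega>]]])
  ultimately show ?thesis by (simp only: prefix_add foldr_append) (auto simp: image_subset_iff)
qed

text \<open>The prefix images form a decreasing sequence of nonempty compact sets, so the finite
  intersection property applies.\<close>

lemma code_point_exists:
  assumes \<omega>: "\<omega> \<in> code_space N"
  shows "\<exists>x. \<forall>n. x \<in> foldr f (map \<omega> [0..<n]) ` K"
proof -
  let ?F = "\<lambda>n. foldr f (map \<omega> [0..<n]) ` K"
  have "K \<inter> (\<Inter>n\<in>UNIV. ?F n) \<noteq> {}"
  proof (rule compact_imp_fip_image[OF compact_K])
    show "closed (?F n)" for n
      by (rule compact_imp_closed[OF compact_word[OF prefix_in_lists[OF \<omega>]]])
    fix J :: "nat set" assume J: "finite J"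
    \<comment> \<open>Among finitely many nested sets the one with the largest index lies in all
      others; inserting 0 takes care of an empty \<open>J\<close>.\<close>
    have "?F (Max (insert 0 J)) \<subseteq> K \<inter> (\<Inter>n\<in>J. ?F n)"
    proof (intro Int_greatest INT_greatest)
      show "?F (Max (insert 0 J)) \<subseteq> K" by (rule foldr_f_K[OF prefix_in_lists[OF \<omega>]])
      show "?F (Max (insert 0 J)) \<subseteq> ?F n" if "n \<in> J" for n
        using J that by (intro prefix_antimono[OF \<omega>]) simp
    qed
    then show "K \<inter> (\<Inter>n\<in>J. ?F n) \<noteq> {}" using K_nonempty by blast
  qed
  then show ?thesis by blast
qed

lemma dist_prefix:
  assumes \<omega>: "\<omega> \<in> code_space N" and "x \<in> foldr f (map \<omega> [0..<n]) ` K" "y \<in> foldr f (map \<omega> [0..<n]) ` K"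
  shows "dist x y \<le> rmax ^ n * diameter K"
proof -
  have w: "map \<omega> [0..<n] \<in> lists {1..N}" by (rule prefix_in_lists[OF \<omega>])
  have "dist x y \<le> ratio (map \<omega> [0..<n]) * diameter K"
    using diameter_word[OF bounded_K w] diameter_bounded_bound assms(2,3) by (meson order_trans)
  also have "\<dots> \<le> rmax ^ n * diameter K"
    using ratio_le[OF w] diameter_ge_0[OF bounded_K] by (intro mult_right_mono) auto
  finally show ?thesis .
qed

lemma code_point_unique:
  assumes \<omega>: "\<omega> \<in> code_space N"
    and x: "\<And>n. x \<in> foldr f (map \<omega> [0..<n]) ` K" and y: "\<And>n. y \<in> foldr f (map \<omega> [0..<n]) ` K"
  shows "x = y"
proof -
  have "dist x y \<le> 0"
    by (rule tendsto_lowerbound[OF rmax_power_tendsto[of "diameter K"]])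
      (intro always_eventually allI dist_prefix[OF \<omega> x y], rule trivial_limit_sequentially)
  then show ?thesis by simp
qed

text \<open>Existence and uniqueness of the code point justify the definite description in
  \<open>code_map\<close>; everything later rests on these two facts.\<close>

lemma code_map_in: "\<omega> \<in> code_space N \<Longrightarrow> code_map f K \<omega> \<in> foldr f (map \<omega> [0..<n]) ` K"
  and code_map_eqI: "\<omega> \<in> code_space N \<Longrightarrow> (\<And>n. x \<in> foldr f (map \<omega> [0..<n]) ` K) \<Longrightarrow> code_map f K \<omega> = x"
proof -
  assume \<omega>: "\<omega> \<in> code_space N"
  obtain z where z: "\<And>n. z \<in> foldr f (map \<omega> [0..<n]) ` K" using code_point_exists[OF \<omega>] by blast
  have "code_map f K \<omega> = z"
    unfolding code_map_def word_map_eq_foldr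
    using z by (intro the_equality) (auto intro: code_point_unique[OF \<omega>])
  then show "code_map f K \<omega> \<in> foldr f (map \<omega> [0..<n]) ` K" by (simp add: z)
  assume "\<And>n. x \<in> foldr f (map \<omega> [0..<n]) ` K"
  then show "code_map f K \<omega> = x" using \<open>code_map f K \<omega> = z\<close> z code_point_unique[OF \<omega>] by blast
qed

lemma code_map_in_K: "\<omega> \<in> code_space N \<Longrightarrow> code_map f K \<omega> \<in> K"
  using code_map_in[of \<omega> 0] by simp

text \<open>\<open>code_map\<close> intertwines the shift with the system. The right-hand side lies
  in the images of all prefixes of length \<open>m + n\<close>, hence by nesting in those of all
  prefixes, and this determines the code point.\<close>

lemma code_map_shift:
  assumes \<omega>: "\<omega> \<in> code_space N"
  shows "code_map f K \<omega> = foldr f (map \<omega> [0..<m]) (code_map f K (shift m \<omega>))"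
proof (rule code_map_eqI[OF \<omega>])
  fix n
  have "foldr f (map \<omega> [0..<m]) (code_map f K (shift m \<omega>)) \<in> foldr f (map \<omega> [0..<m + n]) ` K"
    using code_map_in[OF shift_in_code_space[OF \<omega>], of m n]
    by (simp only: prefix_add foldr_append) (auto simp: image_image[symmetric])
  then show "foldr f (map \<omega> [0..<m]) (code_map f K (shift m \<omega>)) \<in> foldr f (map \<omega> [0..<n]) ` K"
    using prefix_antimono[OF \<omega>, of n "m + n"] by auto
qed

text \<open>The code map is a pointwise limit of functions of finitely many symbols, obtained by
  applying the prefix to a fixed point \<open>z\<close> of \<open>K\<close>.\<close>

lemma code_map_measurable:
  assumes "bernoulli N p \<beta> \<nu>"
  shows "code_map f K \<in> measurable \<nu> (restrict_space borel K)"
proof -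
  interpret bernoulli N p \<beta> \<nu> by fact
  obtain z where z: "z \<in> K" using K_nonempty by blast
  show ?thesis
  proof (rule measurable_restrict_space2)
    show "code_map f K \<in> space \<nu> \<rightarrow> K" by (simp add: code_map_in_K)
    show "code_map f K \<in> borel_measurable \<nu>"
    proof (rule borel_measurable_LIMSEQ_metric)
      show "(\<lambda>\<omega>. foldr f (map \<omega> [0..<n]) z) \<in> borel_measurable \<nu>" for n
        by (rule measurable_compose[OF prefix_measurable]) simp
      fix \<omega> assume "\<omega> \<in> space \<nu>"
      then have \<omega>: "\<omega> \<in> code_space N" by simp
      show "(\<lambda>n. foldr f (map \<omega> [0..<n]) z) \<longlonglongrightarrow> code_map f K \<omega>"
        unfolding tendsto_dist_iff[of _ "code_map f K \<omega>"]
        by (rule tendsto_sandwich[OF _ _ tendsto_const rmax_power_tendsto[of "diameter K"]];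
            intro always_eventually allI zero_le_dist dist_prefix[OF \<omega>] code_map_in[OF \<omega>] imageI z)
    qed
  qed
qed

end

section \<open>Lower bound under strong separation\<close>

lemma compact_disjoint_gap:
  fixes S T :: "'a::metric_space set"
  assumes "compact S" "compact T" "S \<inter> T = {}"
  shows "\<exists>d>0. \<forall>x\<in>S. \<forall>y\<in>T. d \<le> dist x y"
proof (cases "S = {} \<or> T = {}")
  case False
  have "continuous_on (S \<times> T) (\<lambda>z. dist (fst z) (snd z))" by (intro continuous_intros)
  then obtain z where z: "z \<in> S \<times> T" "\<forall>y\<in>S \<times> T. dist (fst z) (snd z) \<le> dist (fst y) (snd y)"
    using continuous_attains_inf[OF compact_Times[OF assms(1,2)]] False by blast
  then have "0 < dist (fst z) (snd z)" using assms(3) by auto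
  moreover have "dist (fst z) (snd z) \<le> dist x y" if "x \<in> S" "y \<in> T" for x y
    using bspec[OF z(2), of "(x, y)"] that by simp
  ultimately show ?thesis by blast
qed (auto intro: exI[of _ 1])

lemma finite_disjoint_gap:
  fixes A :: "'i \<Rightarrow> 'a::metric_space set"
  assumes "finite I" "\<And>i. i \<in> I \<Longrightarrow> compact (A i)"
    and "\<And>i j. i \<in> I \<Longrightarrow> j \<in> I \<Longrightarrow> i \<noteq> j \<Longrightarrow> A i \<inter> A j = {}"
  obtains d where "d > 0"
    "\<And>i j x y. i \<in> I \<Longrightarrow> j \<in> I \<Longrightarrow> i \<noteq> j \<Longrightarrow> x \<in> A i \<Longrightarrow> y \<in> A j \<Longrightarrow> d \<le> dist x y"
proof -
  have "\<exists>d. i \<in> I \<and> j \<in> I \<and> i \<noteq> j \<longrightarrow> 0 < d \<and> (\<forall>x\<in>A i. \<forall>y\<in>A j. d \<le> dist x y)" for i j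
    using compact_disjoint_gap[OF assms(2,2,3)] by blast
  then obtain g where g: "\<And>i j. i \<in> I \<Longrightarrow> j \<in> I \<Longrightarrow> i \<noteq> j \<Longrightarrow> g i j > 0"
      "\<And>i j x y. i \<in> I \<Longrightarrow> j \<in> I \<Longrightarrow> i \<noteq> j \<Longrightarrow> x \<in> A i \<Longrightarrow> y \<in> A j \<Longrightarrow> g i j \<le> dist x y"
    by metis
  \<comment> \<open>The element 1 keeps the minimum defined and positive when there are no pairs of
    distinct indices.\<close>
  define M where "M = insert 1 ((\<lambda>(i, j). g i j) ` {(i, j). i \<in> I \<and> j \<in> I \<and> i \<noteq> j})"
  have "finite {(i, j). i \<in> I \<and> j \<in> I \<and> i \<noteq> j}"
    by (rule finite_subset[of _ "I \<times> I"]) (use assms(1) in auto)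
  then have fin: "finite M" by (simp add: M_def)
  have "\<forall>x\<in>M. 0 < x" using g(1) by (auto simp: M_def)
  then have "0 < Min M" using fin by (subst Min_gr_iff) (simp_all add: M_def)
  moreover have "Min M \<le> dist x y" if *: "i \<in> I" "j \<in> I" "i \<noteq> j" "x \<in> A i" "y \<in> A j" for i j x y
  proof -
    have "g i j \<in> M" unfolding M_def using *(1-3) by (intro insertI2 image_eqI[of _ _ "(i, j)"]) auto
    then have "Min M \<le> g i j" by (rule Min_le[OF fin])
    then show ?thesis using g(2)[OF *] by simp
  qed
  ultimately show ?thesis by (rule that)
qed

text \<open>Mass distribution: the Bernoulli measure with weights proportional to \<open>(r i)\<^sup>s\<close> gives each
  set \<open>E\<close> a mass of at most a constant times \<open>(diameter E)\<^sup>s\<close>, because two codes that first differ at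
  position \<open>k\<close> are mapped to points whose distance is comparable to the ratio of their common prefix.\<close>

lemma (in code_system) hausdorff_measure_pos:
  assumes disj: "\<And>i j. i \<in> {1..N} \<Longrightarrow> j \<in> {1..N} \<Longrightarrow> i \<noteq> j \<Longrightarrow> f i ` K \<inter> f j ` K = {}"
    and s: "0 < s" "1 \<le> (\<Sum>i=1..N. r i powr s)"
  shows "hausdorff_measure s K \<noteq> 0"
proof -
  define S where "S = (\<Sum>i=1..N. r i powr s)"
  have S: "1 \<le> S" using s by (simp add: S_def)
  \<comment> \<open>These weights add up to 1 and are used with exponent 1. Since
    \<open>1 \<le> S\<close>, each is at most \<open>r i powr s\<close>, so the mass of a cylinder
    is at most the \<open>s\<close>-th power of its ratio.\<close>
  define p where "p i = r i powr s / S" for i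
  have p_pos: "0 < p i" if "i \<in> {1..N}" for i
    using r_pos[OF that] S by (simp add: p_def)
  have "(\<Sum>i=1..N. p i powr 1) = (\<Sum>i=1..N. p i)" using p_pos by (intro sum.cong) (auto simp: less_imp_le)
  also have "\<dots> = 1" using S by (simp add: p_def S_def sum_divide_distrib[symmetric])
  finally have "similarity_dimension N p 1" by (simp add: similarity_dimension_def)
  then obtain \<nu> where \<nu>: "is_code_measure N p 1 \<nu>"
    using code_measure_exists[of N p 1] p_pos by blast
  interpret bernoulli N p 1 \<nu> by (rule bernoulli.intro[OF \<nu> p_pos])
  let ?\<pi> = "code_map f K"
  have p_le: "(\<Prod>i\<leftarrow>w. p i) \<le> ratio w powr s \<and> 0 < (\<Prod>i\<leftarrow>w. p i)" if "w \<in> lists {1..N}" for w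
    using that
  proof (induction w)
    case (Cons i w)
    have "p i \<le> r i powr s" using S mult_right_mono[OF S, of "r i powr s"] by (simp add: p_def divide_simps mult.commute)
    then have "p i * (\<Prod>i\<leftarrow>w. p i) \<le> r i powr s * ratio w powr s"
      using Cons p_pos[of i] by (intro mult_mono) auto
    also have "\<dots> = (r i * ratio w) powr s"
      using Cons r_pos[of i] ratio_pos[of w] by (subst powr_mult) auto
    finally show ?case using Cons p_pos[of i] by simp
  qed simp
  have cyl: "prob (cylinder N w) \<le> ratio w powr s" if "w \<in> lists {1..N}" for w
    using p_le[OF that] that by (simp add: prob_cylinder)
  obtain d where d: "d > 0"
      "\<And>i j x y. i \<in> {1..N} \<Longrightarrow> j \<in> {1..N} \<Longrightarrow> i \<noteq> j \<Longrightarrow> x \<in> f i ` K \<Longrightarrow> y \<in> f j ` K \<Longrightarrow> d \<le> dist x y"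
  proof (rule finite_disjoint_gap[of "{1..N}" "\<lambda>i. f i ` K"])
    show "compact (f i ` K)" if "i \<in> {1..N}" for i
      using compact_word[of "[i]"] that by simp
  qed (use disj in auto)
  \<comment> \<open>After the common prefix the codes continue into two different first-level
    images, at distance at least \<open>d\<close>; the prefix scales this distance by its
    ratio.\<close>
  have gap: "ratio (map \<omega> [0..<k]) * d \<le> dist (?\<pi> \<omega>) (?\<pi> \<eta>)"
    if \<omega>: "\<omega> \<in> code_space N" and \<eta>: "\<eta> \<in> code_space N"
      and eq: "map \<omega> [0..<k] = map \<eta> [0..<k]" and ne: "\<omega> k \<noteq> \<eta> k" for \<omega> \<eta> k
  proof -
    define u where "u = map \<omega> [0..<k]"
    have u: "u \<in> lists {1..N}" unfolding u_def by (rule prefix_in_lists[OF \<omega>])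
    obtain x where x: "x \<in> K" "?\<pi> \<omega> = foldr f u (f (\<omega> k) x)"
      using code_map_in[OF \<omega>, of "Suc k"] by (auto simp: u_def)
    obtain y where y: "y \<in> K" "?\<pi> \<eta> = foldr f u (f (\<eta> k) y)"
      using code_map_in[OF \<eta>, of "Suc k"] eq by (auto simp: u_def)
    have "d \<le> dist (f (\<omega> k) x) (f (\<eta> k) y)"
      using \<omega> \<eta> ne x(1) y(1) by (intro d(2)[of "\<omega> k" "\<eta> k"]) (auto simp: code_space_iff)
    then show ?thesis
      using x y ratio_pos[OF u] by (simp add: dist_word[OF u] u_def[symmetric] mult_left_mono)
  qed
  \<comment> \<open>A single code has no place of disagreement to compare with. It is null because
    it lies in cylinders of arbitrarily small mass.\<close>
  have singleton: "\<exists>A\<in>events. Z \<subseteq> A \<and> emeasure \<nu> A = 0" if Z: "Z \<subseteq> {\<omega>}" "\<omega> \<in> code_space N" for Z \<omega>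
  proof -
    define A where "A = (\<Inter>n. cylinder N (map \<omega> [0..<n]))"
    have A: "A \<in> events" by (auto simp: A_def)
    have "prob A \<le> (rmax powr s) ^ n" for n
    proof -
      have w: "map \<omega> [0..<n] \<in> lists {1..N}" by (rule prefix_in_lists[OF Z(2)])
      have "prob A \<le> prob (cylinder N (map \<omega> [0..<n]))"
        by (rule finite_measure_mono) (auto simp: A_def)
      also have "\<dots> \<le> ratio (map \<omega> [0..<n]) powr s" by (rule cyl[OF w])
      also have "\<dots> \<le> (rmax ^ n) powr s"
        using ratio_le[OF w] ratio_pos[OF w] s by (intro powr_mono2) auto
      also have "\<dots> = (rmax powr s) ^ n"
        using rmax_nonneg by (induction n) (auto simp: powr_mult)
      finally show ?thesis .
    qed
    moreover have "(\<lambda>n. (rmax powr s) ^ n) \<longlonglongrightarrow> 0"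
    proof (rule LIMSEQ_power_zero)
      have "rmax powr s < 1 powr s" using rmax_nonneg rmax_less_1 s by (intro powr_less_mono2) auto
      then show "norm (rmax powr s) < 1" by simp
    qed
    ultimately have "prob A \<le> 0" by (intro tendsto_lowerbound[where F = sequentially]) auto
    then have "emeasure \<nu> A = 0" by (simp add: emeasure_eq_measure measure_le_0_iff)
    moreover have "\<omega> \<in> A" using Z(2) by (auto simp: A_def cylinder_iff)
    ultimately show ?thesis using A Z(1) by blast
  qed
  \<comment> \<open>The set \<open>E\<close> is arbitrary, so its set of codes need not be an event;
    an event containing it is measured instead.\<close>
  have mass: "\<exists>A\<in>events. {\<omega> \<in> code_space N. ?\<pi> \<omega> \<in> E} \<subseteq> A \<and>
      emeasure \<nu> A \<le> ennreal (d powr - s) * diam_weight s E" if E: "bounded E" for E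
  proof -
    define Z where "Z = {\<omega> \<in> code_space N. ?\<pi> \<omega> \<in> E}"
    consider "Z = {}" | \<omega> where "Z \<subseteq> {\<omega>}" "\<omega> \<in> code_space N" | \<omega> \<eta> where "\<omega> \<in> Z" "\<eta> \<in> Z" "\<omega> \<noteq> \<eta>"
      by (fastforce simp: Z_def)
    then show ?thesis
    proof cases
      case 1
      then show ?thesis unfolding Z_def[symmetric] by (intro bexI[of _ "{}"]) auto
    next
      case (2 \<omega>)
      from singleton[OF this] obtain A where "A \<in> events" "Z \<subseteq> A" "emeasure \<nu> A = 0" by (elim bexE conjE)
      then show ?thesis unfolding Z_def[symmetric] by (intro bexI[of _ A] conjI) simp_all
    next
      case (3 \<omega> \<eta>)
      \<comment> \<open>The first position at which two codes of \<open>Z\<close> disagree: all of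
        \<open>Z\<close> shares the prefix of length \<open>k\<close>, and a disagreeing pair bounds
        \<open>diameter E\<close> from below.\<close>
      define k where "k = (LEAST k. \<exists>\<omega>\<in>Z. \<exists>\<eta>\<in>Z. \<omega> k \<noteq> \<eta> k)"
      have ex: "\<exists>k. \<exists>\<omega>\<in>Z. \<exists>\<eta>\<in>Z. \<omega> k \<noteq> \<eta> k" using 3 by blast
      have "\<exists>\<omega>\<in>Z. \<exists>\<eta>\<in>Z. \<omega> k \<noteq> \<eta> k" unfolding k_def by (rule LeastI_ex[OF ex])
      then obtain \<omega>' \<eta>' where *: "\<omega>' \<in> Z" "\<eta>' \<in> Z" "\<omega>' k \<noteq> \<eta>' k" by blast
      have agree: "map \<xi> [0..<k] = map \<omega>' [0..<k]" if "\<xi> \<in> Z" for \<xi>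
        using that *(1) not_less_Least[of _ "\<lambda>k. \<exists>\<omega>\<in>Z. \<exists>\<eta>\<in>Z. \<omega> k \<noteq> \<eta> k"]
        by (auto simp: k_def)
      define u where "u = map \<omega>' [0..<k]"
      have u: "u \<in> lists {1..N}" unfolding u_def using *(1) by (intro prefix_in_lists) (simp add: Z_def)
      have "ratio u * d \<le> dist (?\<pi> \<omega>') (?\<pi> \<eta>')"
        unfolding u_def using * agree[of \<eta>'] by (intro gap) (auto simp: Z_def)
      also have "\<dots> \<le> diameter E" using * E by (intro diameter_bounded_bound) (auto simp: Z_def)
      finally have le: "ratio u * d \<le> diameter E" .
      have "prob (cylinder N u) \<le> ratio u powr s" by (rule cyl[OF u])
      also have "\<dots> = d powr - s * (ratio u * d) powr s"
        using d(1) ratio_pos[OF u] by (simp add: powr_mult powr_minus)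
      also have "\<dots> \<le> d powr - s * diameter E powr s"
        using le s d(1) ratio_pos[OF u] by (intro mult_left_mono powr_mono2) auto
      finally have "emeasure \<nu> (cylinder N u) \<le> ennreal (d powr - s) * ennreal (diameter E powr s)"
        by (simp add: emeasure_eq_measure ennreal_mult[symmetric])
      also have "ennreal (diameter E powr s) = diam_weight s E"
        using s * by (auto simp: diam_weight_def Z_def)
      finally have "emeasure \<nu> (cylinder N u) \<le> ennreal (d powr - s) * diam_weight s E" .
      moreover have "Z \<subseteq> cylinder N u"
        using agree by (auto simp: cylinder_iff u_def) (auto simp: Z_def)
      ultimately show ?thesis unfolding Z_def[symmetric] by blast
    qed
  qed
  \<comment> \<open>One mesh is enough for a lower bound, since the Hausdorff measure is the
    supremum over all meshes.\<close>
  have "ennreal (d powr s) \<le> hausdorff_measure_at 1 s K"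
    unfolding hausdorff_measure_at_def
  proof (rule INF_greatest, clarify)
    fix E :: "nat \<Rightarrow> 'a set"
    assume K: "K \<subseteq> (\<Union>n. E n)" and E: "\<forall>n. bounded (E n) \<and> diameter (E n) \<le> 1"
    have "\<forall>n. \<exists>A. A \<in> events \<and> {\<omega> \<in> code_space N. ?\<pi> \<omega> \<in> E n} \<subseteq> A \<and>
      emeasure \<nu> A \<le> ennreal (d powr - s) * diam_weight s (E n)" using mass E by blast
    from choice[OF this] obtain A where A: "A n \<in> events"
      "{\<omega> \<in> code_space N. ?\<pi> \<omega> \<in> E n} \<subseteq> A n"
      "emeasure \<nu> (A n) \<le> ennreal (d powr - s) * diam_weight s (E n)" for n by auto
    have "code_space N \<subseteq> (\<Union>n. A n)"
    proof
      fix \<omega> assume \<omega>: "\<omega> \<in> code_space N"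
      have "?\<pi> \<omega> \<in> (\<Union>n. E n)" by (rule subsetD[OF K code_map_in_K[OF \<omega>]])
      then obtain n where "?\<pi> \<omega> \<in> E n" by (elim UN_E)
      then show "\<omega> \<in> (\<Union>n. A n)" using \<omega> A(2)[of n] by auto
    qed
    then have "1 \<le> emeasure \<nu> (\<Union>n. A n)"
      using A(1) emeasure_space_1 emeasure_mono[of "space \<nu>" "\<Union>n. A n" \<nu>] by auto
    also have "\<dots> \<le> (\<Sum>n. emeasure \<nu> (A n))"
      using A(1) by (intro emeasure_subadditive_countably) auto
    also have "\<dots> \<le> (\<Sum>n. ennreal (d powr - s) * diam_weight s (E n))"
      by (intro suminf_le A(3)) auto
    also have "\<dots> = ennreal (d powr - s) * (\<Sum>n. diam_weight s (E n))" by simp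
    finally have "ennreal (d powr s) * 1 \<le> ennreal (d powr s) * (ennreal (d powr - s) * (\<Sum>n. diam_weight s (E n)))"
      by (rule mult_left_mono) simp
    also have "\<dots> = (\<Sum>n. diam_weight s (E n))"
      using d(1) by (simp add: mult.assoc[symmetric] ennreal_mult[symmetric] powr_minus)
    finally show "ennreal (d powr s) \<le> (\<Sum>n. diam_weight s (E n))" by simp
  qed
  also have "\<dots> \<le> hausdorff_measure s K"
    unfolding hausdorff_measure_def by (rule SUP_upper) simp
  finally show ?thesis using d(1) by auto
qed

text \<open>Code spaces have the letters \<open>{1..N}\<close>, so a general finite index set is
  first enumerated. This form is applied with words as indices.\<close>

lemma (in similitudes) hausdorff_measure_pos:
  assumes K: "compact K" "K \<noteq> {}" "\<And>i. i \<in> I \<Longrightarrow> f i ` K \<subseteq> K"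
    and disj: "\<And>i j. i \<in> I \<Longrightarrow> j \<in> I \<Longrightarrow> i \<noteq> j \<Longrightarrow> f i ` K \<inter> f j ` K = {}"
    and s: "0 < s" "1 \<le> (\<Sum>i\<in>I. r i powr s)"
  shows "hausdorff_measure s K \<noteq> 0"
proof -
  obtain h where h: "bij_betw h {1..card I} I" using ex_bij_betw_nat_finite_1[OF finite_I] by blast
  then have hI: "h i \<in> I" if "i \<in> {1..card I}" for i using that by (rule bij_betwE[rule_format])
  interpret h: code_system "card I" "\<lambda>i. f (h i)" "\<lambda>i. r (h i)" K
    by unfold_locales (use K hI similitude in auto)
  show ?thesis
  proof (rule h.hausdorff_measure_pos)
    show "1 \<le> (\<Sum>i=1..card I. r (h i) powr s)"
      using s(2) sum.reindex_bij_betw[OF h, of "\<lambda>i. r i powr s"] by simp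
    fix i j assume ij: "i \<in> {1..card I}" "j \<in> {1..card I}" "i \<noteq> j"
    then have "h i \<noteq> h j" using h by (meson bij_betw_def inj_onD)
    then show "f (h i) ` K \<inter> f (h j) ` K = {}" using ij by (intro disj hI)
  qed fact
qed

section \<open>Self-similar sets\<close>

declare One_nat_def [simp del]

lemma hausdorff_dim_ge:
  assumes "\<And>s. 0 \<le> s \<Longrightarrow> s < t \<Longrightarrow> hausdorff_measure s A \<noteq> 0"
  shows "ereal t \<le> hausdorff_dim A"
  unfolding hausdorff_dim_def
proof (rule Inf_greatest, clarify)
  fix s :: real assume "0 \<le> s" "hausdorff_measure s A = 0"
  then show "ereal t \<le> ereal s" using assms[of s] by (cases "s < t") auto
qed

text \<open>If \<open>G\<close> is not inside one member \<open>P\<close> of the cover, then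
  \<open>G - P\<close> is nonempty, relatively open and covered by the remaining members, so
  induction applies.\<close>

lemma finite_closed_cover_interior:
  fixes G :: "'a::topological_space set"
  assumes "finite C" "\<And>P. P \<in> C \<Longrightarrow> closed P" "openin (top_of_set K) G" "G \<noteq> {}" "G \<subseteq> \<Union>C"
  shows "\<exists>P\<in>C. \<exists>W. openin (top_of_set K) W \<and> W \<noteq> {} \<and> W \<subseteq> P"
  using assms
proof (induction C arbitrary: G)
  case (insert P C)
  show ?case
  proof (cases "G \<subseteq> P")
    case True
    then show ?thesis using insert.prems by blast
  next
    case False
    have "closedin (top_of_set K) (K \<inter> P)" using insert.prems by (intro closedin_closed_Int) auto
    then have "openin (top_of_set K) (G - K \<inter> P)" using insert.prems by (intro openin_diff)
    moreover have "G - K \<inter> P = G - P" using openin_imp_subset[OF insert.prems(2)] by blast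
    ultimately have G': "openin (top_of_set K) (G - P)" by simp
    have "\<exists>P\<in>C. \<exists>W. openin (top_of_set K) W \<and> W \<noteq> {} \<and> W \<subseteq> P"
    proof (rule insert.IH[OF _ G'])
      show "closed P" if "P \<in> C" for P using insert.prems(1) that by simp
      show "G - P \<noteq> {}" "G - P \<subseteq> \<Union>C" using False insert.prems(4) by auto
    qed
    then show ?thesis by blast
  qed
qed auto

locale ifs = code_system +
  fixes \<alpha> :: real
  assumes K_subset: "K \<subseteq> (\<Union>i\<in>{1..N}. f i ` K)"
    and \<alpha>: "(\<Sum>i=1..N. r i powr \<alpha>) = 1"
begin

section \<open>The similarity dimension: monotonicity, sign and comparison with the Hausdorff
  dimension\<close>

lemma N_pos: "{1..N} \<noteq> {}"
  using K_subset K_nonempty by auto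

lemma sum_powr_strict_antimono: "s < t \<Longrightarrow> (\<Sum>i=1..N. r i powr t) < (\<Sum>i=1..N. r i powr s)"
  by (rule sum_strict_mono[OF _ N_pos]) (auto intro!: powr_less_mono' r_pos r_less_1)

lemma sum_powr_0: "(\<Sum>i=1..N. r i powr 0) = real N"
proof -
  have "r i powr 0 = 1" if "i \<in> {1..N}" for i using r_pos[OF that] by simp
  then show ?thesis by simp
qed

lemma \<alpha>_nonneg: "0 \<le> \<alpha>"
proof (rule ccontr)
  assume "\<not> 0 \<le> \<alpha>"
  then have "(\<Sum>i=1..N. r i powr 0) < 1" using sum_powr_strict_antimono[of \<alpha> 0] \<alpha> by simp
  then have "real N < 1" by (simp only: sum_powr_0)
  then show False using N_pos by simp
qed

lemma \<alpha>_pos: "1 < N \<Longrightarrow> 0 < \<alpha>"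
proof (rule ccontr)
  assume "1 < N" "\<not> 0 < \<alpha>"
  then have "\<alpha> = 0" using \<alpha>_nonneg by simp
  then have "real N = 1" using \<alpha> by (simp only: sum_powr_0)
  then show False using \<open>1 < N\<close> by simp
qed

text \<open>Every exponent above \<open>\<alpha>\<close> makes the sum of powers of the ratios
  smaller than 1, so the Hausdorff measure vanishes there.\<close>

lemma hausdorff_dim_le_\<alpha>: "hausdorff_dim K \<le> ereal \<alpha>"
proof (rule ereal_le_epsilon2[rule_format])
  fix e :: real assume e: "0 < e"
  have "hausdorff_measure (\<alpha> + e) K = 0"
    using e \<alpha>_nonneg sum_powr_strict_antimono[of \<alpha> "\<alpha> + e"] \<alpha>
    by (intro hausdorff_measure_eq_0 bounded_K K_subset) auto
  then have "hausdorff_dim K \<le> ereal (\<alpha> + e)" using e \<alpha>_nonneg by (intro hausdorff_dim_le) auto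
  then show "hausdorff_dim K \<le> ereal \<alpha> + ereal e" by simp
qed

text \<open>A common first letter cancels by injectivity. If the first letters differ, the tail of
  \<open>u\<close> keeps \<open>V\<close> inside \<open>V\<close> and the tail of \<open>v\<close>
  keeps \<open>K\<close> inside \<open>K\<close>, so the condition for single letters
  applies.\<close>

lemma word_maps_disjoint:
  assumes V: "V \<subseteq> K" "\<And>i. i \<in> {1..N} \<Longrightarrow> f i ` V \<subseteq> V"
      "\<And>i j. i \<in> {1..N} \<Longrightarrow> j \<in> {1..N} \<Longrightarrow> i \<noteq> j \<Longrightarrow> f i ` V \<inter> f j ` K = {}"
    and "length u = length v" "u \<in> lists {1..N}" "v \<in> lists {1..N}" "u \<noteq> v"
  shows "foldr f u ` V \<inter> foldr f v ` K = {}"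
  using assms(4-)
proof (induction u v rule: list_induct2)
  case (Cons i u j v)
  then have ij: "i \<in> {1..N}" "j \<in> {1..N}" "u \<in> lists {1..N}" "v \<in> lists {1..N}" by auto
  show ?case
  proof (cases "i = j")
    case True
    have "foldr f (i # u) ` V \<inter> foldr f (j # v) ` K = f i ` (foldr f u ` V \<inter> foldr f v ` K)"
      using image_Int[OF inj_f[OF ij(1)]] by (simp add: True image_comp)
    then show ?thesis using Cons True ij by simp
  next
    case False
    have "foldr f (i # u) ` V \<subseteq> f i ` V"
      using word_subset[OF V(2) ij(3)] by auto
    moreover have "foldr f (j # v) ` K \<subseteq> f j ` K"
      using foldr_f_K[OF ij(4)] by auto
    ultimately show ?thesis using V(3)[OF ij(1,2) False] by blast
  qed
qed simp

lemma SOSC_imp_hausdorff_dim: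
  assumes "SOSC_in N f K"
  shows "hausdorff_dim K = ereal \<alpha>"
proof (rule antisym[OF hausdorff_dim_le_\<alpha>], rule hausdorff_dim_ge)
  obtain V where V: "V \<noteq> {}" "V \<subseteq> K" "openin (top_of_set K) V"
      "\<And>i. i \<in> {1..N} \<Longrightarrow> f i ` V \<subseteq> V"
      "\<And>i j. i \<in> {1..N} \<Longrightarrow> j \<in> {1..N} \<Longrightarrow> i \<noteq> j \<Longrightarrow> f i ` V \<inter> f j ` K = {}"
    using assms unfolding SOSC_in_def by metis
  obtain w where w: "w \<in> lists {1..N}" "foldr f w ` K \<subseteq> V"
    using word_in_open[OF bounded_K K_subset f_K V(3,1)] by blast
  fix s assume s: "0 \<le> s" "s < \<alpha>"
  show "hausdorff_measure s K \<noteq> 0"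
  proof (cases "s = 0")
    case True
    then show ?thesis by (simp add: hausdorff_measure_0 K_nonempty)
  next
    case False
    define q where "q = (\<Sum>i=1..N. r i powr s)"
    have q: "1 < q" using sum_powr_strict_antimono[OF s(2)] \<alpha> by (simp add: q_def)
    obtain m where m: "inverse (ratio w powr s) < q ^ m" using real_arch_pow[OF q] by blast
    \<comment> \<open>The extra letter makes \<open>v @ w\<close> nonempty even if \<open>w\<close>
      is empty; the empty word would not be a contraction.\<close>
    define n where "n = Suc m"
    have "q ^ m \<le> q ^ n" unfolding n_def using q by (intro power_increasing) auto
    then have "inverse (ratio w powr s) \<le> q ^ n" using m by simp
    then have "1 \<le> q ^ n * ratio w powr s"
      using ratio_pos[OF w(1)] by (simp add: field_simps)
    interpret n: similitudes "words {1..N} n" "\<lambda>v. foldr f (v @ w)" "\<lambda>v. ratio (v @ w)"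
    proof
      show "finite (words {1..N} n)" by simp
      fix v assume "v \<in> words {1..N} n"
      then show "contracting_similitude (ratio (v @ w)) (foldr f (v @ w))"
        using w(1) by (intro similitude_word) (auto simp: words_def n_def)
    qed
    show ?thesis
    proof (rule n.hausdorff_measure_pos[OF compact_K K_nonempty])
      fix v assume v: "v \<in> words {1..N} n"
      show "foldr f (v @ w) ` K \<subseteq> K" using v w by (intro foldr_f_K) (auto simp: words_def)
      fix v' assume v': "v' \<in> words {1..N} n" "v \<noteq> v'"
      \<comment> \<open>Disjointness is known between an image of \<open>V\<close> and an image of
        \<open>K\<close>, so one of the two sets is enlarged to each kind.\<close>
      have "foldr f (v @ w) ` K \<subseteq> foldr f v ` V" using w(2) by auto
      moreover have "foldr f (v' @ w) ` K \<subseteq> foldr f v' ` K" using foldr_f_K[OF w(1)] by auto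
      moreover have "foldr f v ` V \<inter> foldr f v' ` K = {}"
        using v v' by (intro word_maps_disjoint[OF V(2,4,5)]) (auto simp: words_def)
      ultimately show "foldr f (v @ w) ` K \<inter> foldr f (v' @ w) ` K = {}" by blast
    next
      show "0 < s" using s False by simp
      have "(\<Sum>v\<in>words {1..N} n. ratio (v @ w) powr s) = (\<Sum>v\<in>words {1..N} n. ratio v powr s) * ratio w powr s"
        unfolding sum_distrib_right
        using ratio_pos w(1) by (intro sum.cong) (auto simp: words_def powr_mult less_imp_le)
      also have "\<dots> = q ^ n * ratio w powr s" by (simp add: sum_ratio_powr q_def)
      finally show "1 \<le> (\<Sum>v\<in>words {1..N} n. ratio (v @ w) powr s)"
        using \<open>1 \<le> q ^ n * ratio w powr s\<close> by simp
    qed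
  qed
qed

section \<open>The similarity boundary, and the dimension drop when it has interior\<close>

definition overlap :: "nat \<Rightarrow> nat \<Rightarrow> 'a set" where
  "overlap j k = {x \<in> K. f j x \<in> f k ` K}"

text \<open>Since \<open>f j\<close> is injective, the preimage contributed by the pair
  \<open>(j, k)\<close> consists exactly of the points of \<open>K\<close> that \<open>f j\<close>
  sends into the image of \<open>f k\<close>.\<close>

lemma similarity_boundary_eq:
  "similarity_boundary N f K = (\<Union>(j, k)\<in>Sigma {1..N} (\<lambda>j. {1..N} - {j}). overlap j k)"
proof -
  have "f j -` (f j ` K \<inter> f k ` K) = overlap j k" if "j \<in> {1..N}" for j k
    by (auto simp: overlap_def inj_eq[OF inj_f[OF that]])
  then have "similarity_boundary N f K = (\<Union>j\<in>{1..N}. \<Union>k\<in>{1..N} - {j}. overlap j k)"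
    unfolding similarity_boundary_def by (intro SUP_cong refl)
  also have "\<dots> = (\<Union>(j, k)\<in>Sigma {1..N} (\<lambda>j. {1..N} - {j}). overlap j k)"
    by blast
  finally show ?thesis .
qed

lemma finite_pairs: "finite (Sigma {1..N} (\<lambda>j. {1..N} - {j}))"
  by simp

lemma closed_f_K: "i \<in> {1..N} \<Longrightarrow> closed (f i ` K)"
  using compact_imp_closed[OF compact_word[of "[i]"]] by simp

lemma closed_overlap: "j \<in> {1..N} \<Longrightarrow> k \<in> {1..N} \<Longrightarrow> closed (overlap j k)"
proof -
  assume "j \<in> {1..N}" "k \<in> {1..N}"
  then have "closed (K \<inter> f j -` (f k ` K))"
    by (intro closed_Int compact_imp_closed[OF compact_K] closed_vimage closed_f_K continuous_on_f)
  then show ?thesis by (simp add: overlap_def vimage_def Int_def)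
qed

lemma similarity_boundary_subset: "similarity_boundary N f K \<subseteq> K"
  by (auto simp: similarity_boundary_eq overlap_def)

lemma closed_similarity_boundary: "closed (similarity_boundary N f K)"
  unfolding similarity_boundary_eq
  by (rule closed_UN[OF finite_pairs]) (auto intro: closed_overlap)

lemma hausdorff_dim_less:
  assumes "top_of_set K interior_of similarity_boundary N f K \<noteq> {}"
  shows "hausdorff_dim K < ereal \<alpha>"
proof -
  let ?P = "Sigma {1..N} (\<lambda>j. {1..N} - {j})"
  let ?O = "top_of_set K interior_of similarity_boundary N f K"
  have "?O \<subseteq> \<Union>((\<lambda>(j, k). overlap j k) ` ?P)"
    using interior_of_subset[of "top_of_set K" "similarity_boundary N f K"]
    by (simp only: similarity_boundary_eq)
  moreover have "closed P" if "P \<in> (\<lambda>(j, k). overlap j k) ` ?P" for P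
    using that closed_overlap by auto
  \<comment> \<open>The boundary is a finite union of closed overlaps, so one of them must contain a
    nonempty relatively open set.\<close>
  ultimately have "\<exists>P\<in>(\<lambda>(j, k). overlap j k) ` ?P. \<exists>W. openin (top_of_set K) W \<and> W \<noteq> {} \<and> W \<subseteq> P"
    using assms by (intro finite_closed_cover_interior[of _ K ?O] finite_imageI finite_pairs openin_interior_of)
  then obtain P W where P: "P \<in> (\<lambda>(j, k). overlap j k) ` ?P"
      and W: "openin (top_of_set K) W" "W \<noteq> {}" "W \<subseteq> P"
    by (elim bexE exE conjE)
  obtain j k where jk: "j \<in> {1..N}" "k \<in> {1..N}" "j \<noteq> k" "W \<subseteq> overlap j k"
  proof -
    obtain j k where "(j, k) \<in> ?P" "P = overlap j k" using P by (elim imageE) (simp split: prod.splits)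
    then show ?thesis using W(3) by (intro that[of j k]) (simp_all only: mem_Sigma_iff Diff_iff insert_iff, simp)
  qed
  obtain w where w: "w \<in> lists {1..N}" "foldr f w ` K \<subseteq> W"
    using word_in_open[OF bounded_K K_subset f_K W(1,2)] by blast
  have drop: "foldr f (j # w) ` K \<subseteq> f k ` K"
    using w(2) jk(4) by (auto simp: overlap_def)
  define n where "n = length w"
  \<comment> \<open>All words one letter longer than \<open>w\<close>, with \<open>j # w\<close>
    deleted, because \<open>drop\<close> makes its image redundant.\<close>
  define J where "J = words {1..N} (Suc n) - {j # w}"
  have jw: "j # w \<in> words {1..N} (Suc n)" using w jk by (auto simp: words_def n_def)
  interpret J: similitudes J "foldr f" ratio
  proof
    show "finite J" by (simp add: J_def)
    fix v assume "v \<in> J"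
    then show "contracting_similitude (ratio v) (foldr f v)"
      by (intro similitude_word) (auto simp: J_def words_def)
  qed
  have cover: "K \<subseteq> (\<Union>v\<in>J. foldr f v ` K)"
  proof
    fix x assume "x \<in> K"
    then obtain v where v: "v \<in> words {1..N} (Suc n)" "x \<in> foldr f v ` K"
      using cover_words[OF K_subset] by blast
    show "x \<in> (\<Union>v\<in>J. foldr f v ` K)"
    proof (cases "v = j # w")
      case True
      \<comment> \<open>A point of the deleted image also has a description starting with
        \<open>k\<close>, and such a word survives in \<open>J\<close> because \<open>k\<close>
        differs from \<open>j\<close>.\<close>
      then obtain y where y: "y \<in> K" "x = f k y" using v(2) drop by blast
      then obtain u where u: "u \<in> words {1..N} n" "y \<in> foldr f u ` K"
        using cover_words[OF K_subset] by blast
      have "k # u \<in> J" using u(1) jk by (auto simp: J_def words_def)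
      moreover have "x \<in> foldr f (k # u) ` K" using y u(2) by auto
      ultimately show ?thesis by blast
    qed (use v in \<open>auto simp: J_def\<close>)
  qed
  \<comment> \<open>Deleting a positive term pushes \<open>h\<close> below 1 at
    \<open>\<alpha>\<close>; by continuity it is still below 1 at some smaller exponent.\<close>
  define h where "h s = (\<Sum>v\<in>J. ratio v powr s)" for s
  have pos: "0 < ratio v" if "v \<in> J" for v using that by (intro ratio_pos) (auto simp: J_def words_def)
  have "h \<alpha> = (\<Sum>v\<in>words {1..N} (Suc n). ratio v powr \<alpha>) - ratio (j # w) powr \<alpha>"
    unfolding h_def J_def using jw by (simp add: sum_diff1)
  also have "\<dots> < 1" using ratio_pos[OF w(1)] r_pos[OF jk(1)] by (simp add: sum_ratio_powr \<alpha>)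
  finally have "h \<alpha> < 1" .
  moreover have "isCont h \<alpha>" unfolding h_def by (intro continuous_intros) (metis pos less_irrefl)
  ultimately have "eventually (\<lambda>s. h s < 1) (at_left \<alpha>)"
    by (metis continuous_at_imp_continuous_at_within continuous_within order_tendstoD(2))
  \<comment> \<open>Two distinct indices force \<open>1 < N\<close> and hence a positive
    \<open>\<alpha>\<close>, which leaves room for a positive exponent below it.\<close>
  moreover have "0 < \<alpha>" using jk by (intro \<alpha>_pos) auto
  then have "eventually (\<lambda>s. 0 < s \<and> s < \<alpha>) (at_left \<alpha>)"
    using eventually_at_left_real by (metis (mono_tags, lifting) eventually_mono greaterThanLessThan_iff)
  ultimately have "eventually (\<lambda>s. h s < 1 \<and> 0 < s \<and> s < \<alpha>) (at_left \<alpha>)"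
    by (rule eventually_conj)
  then obtain s where s: "h s < 1" "0 < s" "s < \<alpha>"
    using eventually_happens[of _ "at_left \<alpha>"] by auto
  then have "hausdorff_measure s K = 0"
    using cover by (intro J.hausdorff_measure_eq_0 bounded_K) (auto simp: h_def)
  then have "hausdorff_dim K \<le> ereal s" using s by (intro hausdorff_dim_le) auto
  then show ?thesis using s(3) by (simp add: le_less_trans)
qed

end

section \<open>The measure conditions, translated to the code space\<close>

context ifs
begin

abbreviation \<nu> :: "(nat \<Rightarrow> nat) measure" where
  "\<nu> \<equiv> code_measure N r \<alpha>"

abbreviation \<mu> :: "'a measure" where
  "\<mu> \<equiv> image_measure N f r \<alpha> K"

sublocale code: bernoulli N r \<alpha> \<nu>
  by (rule bernoulli.intro[OF is_code_measure_code_measure])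
    (auto simp: r_pos \<alpha> similarity_dimension_def)

definition codes :: "'a set \<Rightarrow> (nat \<Rightarrow> nat) set" where
  "codes S = {\<omega> \<in> code_space N. code_map f K \<omega> \<in> S}"

lemma codes_sets: "closed S \<Longrightarrow> S \<subseteq> K \<Longrightarrow> codes S \<in> code.events"
  and measure_image: "closed S \<Longrightarrow> S \<subseteq> K \<Longrightarrow> measure \<mu> S = code.prob (codes S)"
proof -
  assume S: "closed S" "S \<subseteq> K"
  have meas: "code_map f K \<in> measurable \<nu> (restrict_space borel K)"
    by (rule code_map_measurable) (rule code.bernoulli_axioms)
  have "K \<in> sets borel" using compact_K by (simp add: compact_imp_closed)
  then have S': "S \<in> sets (restrict_space borel K)"
    using S by (simp add: sets_restrict_space_iff)
  have eq: "codes S = code_map f K -` S \<inter> space \<nu>" by (auto simp: codes_def)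
  show "codes S \<in> code.events" unfolding eq by (rule measurable_sets[OF meas S'])
  show "measure \<mu> S = code.prob (codes S)"
    unfolding eq image_measure_def by (rule measure_distr[OF meas S'])
qed

lemma codes_f_K_sets: "i \<in> {1..N} \<Longrightarrow> codes (f i ` K) \<in> code.events"
  by (intro codes_sets closed_f_K f_K)

text \<open>In general only an inclusion: a point of the word image may have further codes outside
  the cylinder. This excess is what the measure conditions control.\<close>

lemma cylinder_subset_codes: "cylinder N w \<subseteq> codes (foldr f w ` K)"
proof
  fix \<omega> assume "\<omega> \<in> cylinder N w"
  then show "\<omega> \<in> codes (foldr f w ` K)" using code_map_in[of \<omega> "length w"] by (simp add: codes_def cylinder_iff)
qed

lemma cylinder_single_iff: "\<omega> \<in> cylinder N [i] \<longleftrightarrow> \<omega> \<in> code_space N \<and> \<omega> 0 = i"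
  by (simp add: cylinder_def)

lemma prob_cylinder_1: "i \<in> {1..N} \<Longrightarrow> code.prob (cylinder N [i]) = r i powr \<alpha>"
  using code.prob_cylinder[of "[i]"] by simp

lemma null_mono:
  "A \<subseteq> C \<Longrightarrow> C \<in> code.events \<Longrightarrow> code.prob C = 0 \<Longrightarrow> code.prob A = 0"
  using code.finite_measure_mono[of A C] measure_nonneg[of \<nu> A] by linarith

lemma null_UN:
  assumes "finite J" "\<And>j. j \<in> J \<Longrightarrow> A j \<in> code.events" "\<And>j. j \<in> J \<Longrightarrow> code.prob (A j) = 0"
  shows "code.prob (\<Union>j\<in>J. A j) = 0"
proof -
  have "code.prob (\<Union>j\<in>J. A j) \<le> (\<Sum>j\<in>J. code.prob (A j))"
    using assms by (intro code.finite_measure_subadditive_finite) auto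
  then show ?thesis using assms(3) by (simp add: measure_le_0_iff)
qed

text \<open>The common reformulation of conditions (5), (6) and (7).\<close>

definition essentially_disjoint :: bool where
  "essentially_disjoint \<longleftrightarrow> (\<forall>i\<in>{1..N}. \<forall>j\<in>{1..N}. i \<noteq> j \<longrightarrow>
     code.prob (cylinder N [j] \<inter> codes (f i ` K)) = 0)"

text \<open>The cylinder of \<open>i\<close> has mass \<open>r i powr \<alpha>\<close> and lies in
  the codes of the image under \<open>f i\<close>, so equality of measures means that the excess is
  null.\<close>

lemma measure_f_K_iff:
  "(\<forall>i\<in>{1..N}. measure \<mu> (f i ` K) = r i powr \<alpha>) \<longleftrightarrow>
   (\<forall>i\<in>{1..N}. code.prob (codes (f i ` K) - cylinder N [i]) = 0)"
proof (intro ball_cong refl)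
  fix i assume i: "i \<in> {1..N}"
  have "code.prob (codes (f i ` K) - cylinder N [i]) = measure \<mu> (f i ` K) - r i powr \<alpha>"
    using cylinder_subset_codes[of "[i]"] i codes_f_K_sets[OF i]
    by (subst code.finite_measure_Diff) (simp_all add: prob_cylinder_1 measure_image closed_f_K f_K)
  then show "(measure \<mu> (f i ` K) = r i powr \<alpha>) \<longleftrightarrow> (code.prob (codes (f i ` K) - cylinder N [i]) = 0)"
    by simp
qed

text \<open>The excess over the cylinder of \<open>i\<close> splits according to the first letter
  \<open>j \<noteq> i\<close> into finitely many pieces.\<close>

lemma essentially_disjoint_iff:
  "essentially_disjoint \<longleftrightarrow> (\<forall>i\<in>{1..N}. code.prob (codes (f i ` K) - cylinder N [i]) = 0)"
proof
  assume *: "\<forall>i\<in>{1..N}. code.prob (codes (f i ` K) - cylinder N [i]) = 0"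
  show essentially_disjoint
    unfolding essentially_disjoint_def
  proof (intro ballI impI)
    fix i j assume ij: "i \<in> {1..N}" "j \<in> {1..N}" "i \<noteq> j"
    show "code.prob (cylinder N [j] \<inter> codes (f i ` K)) = 0"
    proof (rule null_mono)
      show "cylinder N [j] \<inter> codes (f i ` K) \<subseteq> codes (f i ` K) - cylinder N [i]"
        using ij(3) by (auto simp: cylinder_single_iff)
    qed (use * ij codes_f_K_sets in auto)
  qed
next
  assume *: essentially_disjoint
  show "\<forall>i\<in>{1..N}. code.prob (codes (f i ` K) - cylinder N [i]) = 0"
  proof
    fix i assume i: "i \<in> {1..N}"
    have "codes (f i ` K) - cylinder N [i] = (\<Union>j\<in>{1..N} - {i}. cylinder N [j] \<inter> codes (f i ` K))"
    proof (intro equalityI subsetI)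
      fix \<omega> assume \<omega>: "\<omega> \<in> codes (f i ` K) - cylinder N [i]"
      then have "\<omega> \<in> code_space N" "\<omega> 0 \<noteq> i" by (auto simp: codes_def cylinder_single_iff)
      then have "\<omega> 0 \<in> {1..N} - {i}" by (simp add: code_space_iff)
      moreover have "\<omega> \<in> cylinder N [\<omega> 0] \<inter> codes (f i ` K)"
        using \<omega> by (simp add: codes_def cylinder_single_iff)
      ultimately show "\<omega> \<in> (\<Union>j\<in>{1..N} - {i}. cylinder N [j] \<inter> codes (f i ` K))" by (rule UN_I)
    qed (auto simp: cylinder_single_iff)
    also have "code.prob \<dots> = 0"
      using * i codes_f_K_sets[OF i] by (intro null_UN) (auto simp: essentially_disjoint_def)
    finally show "code.prob (codes (f i ` K) - cylinder N [i]) = 0" .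
  qed
qed

text \<open>A code has only one first letter, so a code of a common point lies outside the cylinder
  of \<open>i\<close> or that of \<open>j\<close>, hence in one of two null excess sets. Conversely
  the cylinder of \<open>j\<close> lies in the codes of the image under \<open>f j\<close>.\<close>

lemma measure_Int_iff:
  "(\<forall>i\<in>{1..N}. \<forall>j\<in>{1..N}. i \<noteq> j \<longrightarrow> measure \<mu> (f i ` K \<inter> f j ` K) = 0) \<longleftrightarrow> essentially_disjoint"
proof -
  have Int: "measure \<mu> (f i ` K \<inter> f j ` K) = code.prob (codes (f i ` K) \<inter> codes (f j ` K))"
    if "i \<in> {1..N}" "j \<in> {1..N}" for i j
  proof -
    have "codes (f i ` K \<inter> f j ` K) = codes (f i ` K) \<inter> codes (f j ` K)" by (auto simp: codes_def)
    moreover have "closed (f i ` K \<inter> f j ` K)" using that by (intro closed_Int closed_f_K)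
    moreover have "f i ` K \<inter> f j ` K \<subseteq> K" using f_K[OF that(1)] by blast
    ultimately show ?thesis by (simp add: measure_image)
  qed
  show ?thesis
  proof
    assume *: "\<forall>i\<in>{1..N}. \<forall>j\<in>{1..N}. i \<noteq> j \<longrightarrow> measure \<mu> (f i ` K \<inter> f j ` K) = 0"
    show essentially_disjoint
      unfolding essentially_disjoint_def
    proof (intro ballI impI)
      fix i j assume ij: "i \<in> {1..N}" "j \<in> {1..N}" "i \<noteq> j"
      show "code.prob (cylinder N [j] \<inter> codes (f i ` K)) = 0"
      proof (rule null_mono)
        show "cylinder N [j] \<inter> codes (f i ` K) \<subseteq> codes (f i ` K) \<inter> codes (f j ` K)"
          using cylinder_subset_codes[of "[j]"] ij by auto
      qed (use * ij codes_f_K_sets in \<open>auto simp: Int\<close>)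
    qed
  next
    assume essentially_disjoint
    then have *: "code.prob (codes (f i ` K) - cylinder N [i]) = 0" if "i \<in> {1..N}" for i
      using that by (simp only: essentially_disjoint_iff)
    show "\<forall>i\<in>{1..N}. \<forall>j\<in>{1..N}. i \<noteq> j \<longrightarrow> measure \<mu> (f i ` K \<inter> f j ` K) = 0"
    proof (intro ballI impI)
      fix i j assume ij: "i \<in> {1..N}" "j \<in> {1..N}" "i \<noteq> j"
      have ev: "codes (f k ` K) - cylinder N [k] \<in> code.events" if "k \<in> {i, j}" for k
        using that ij codes_f_K_sets by auto
      show "measure \<mu> (f i ` K \<inter> f j ` K) = 0"
        unfolding Int[OF ij(1,2)]
      proof (rule null_mono)
        show "codes (f i ` K) \<inter> codes (f j ` K) \<subseteq> (\<Union>k\<in>{i, j}. codes (f k ` K) - cylinder N [k])"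
          using ij(3) by (auto simp: cylinder_single_iff)
        show "(\<Union>k\<in>{i, j}. codes (f k ` K) - cylinder N [k]) \<in> code.events"
          using ev by (intro sets.finite_UN) auto
        show "code.prob (\<Union>k\<in>{i, j}. codes (f k ` K) - cylinder N [k]) = 0"
          using ev * ij(1,2) by (intro null_UN) auto
      qed
    qed
  qed
qed

lemma overlap_subset: "overlap j k \<subseteq> K"
  by (auto simp: overlap_def)

text \<open>A code starting with \<open>j\<close> represents \<open>f j\<close> of the point of its
  shift, so that point is in the image of \<open>f k\<close> exactly if the shifted code represents
  a point of the overlap. Independence of the first letter and the shift gives the product.\<close>

lemma prob_codes_overlap:
  assumes jk: "j \<in> {1..N}" "k \<in> {1..N}"
  shows "code.prob (cylinder N [j] \<inter> codes (f k ` K)) = r j powr \<alpha> * code.prob (codes (overlap j k))"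
proof -
  have "cylinder N [j] \<inter> codes (f k ` K) = cylinder N [j] \<inter> {\<omega>. shift (length [j]) \<omega> \<in> codes (overlap j k)}"
  proof (intro set_eqI)
    fix \<omega>
    show "\<omega> \<in> cylinder N [j] \<inter> codes (f k ` K) \<longleftrightarrow>
        \<omega> \<in> cylinder N [j] \<inter> {\<omega>. shift (length [j]) \<omega> \<in> codes (overlap j k)}"
    proof (cases "\<omega> \<in> cylinder N [j]")
      case True
      then have \<omega>: "\<omega> \<in> code_space N" "map \<omega> [0..<length [j]] = [j]" by (auto simp only: cylinder_iff)
      have shift: "shift (length [j]) \<omega> \<in> code_space N" by (rule shift_in_code_space[OF \<omega>(1)])
      have "code_map f K \<omega> = f j (code_map f K (shift (length [j]) \<omega>))"
        using code_map_shift[OF \<omega>(1), of "length [j]"] unfolding \<omega>(2) by simp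
      then show ?thesis
        using True \<omega>(1) shift code_map_in_K[OF shift]
        by (simp only: codes_def overlap_def Int_iff mem_Collect_eq simp_thms)
    qed simp
  qed
  also have "code.prob \<dots> = code.prob (cylinder N [j]) * code.prob (codes (overlap j k))"
    using jk by (intro code.prob_cylinder_shift codes_sets closed_overlap overlap_subset) auto
  finally show ?thesis using jk by (simp add: prob_cylinder_1)
qed

text \<open>The boundary is a finite union of overlaps, and each of these has the mass of a piece in
  \<open>essentially_disjoint\<close> up to the positive factor
  \<open>r j powr \<alpha>\<close>.\<close>

lemma measure_boundary_iff: "measure \<mu> (similarity_boundary N f K) = 0 \<longleftrightarrow> essentially_disjoint"
proof -
  let ?P = "Sigma {1..N} (\<lambda>j. {1..N} - {j})"
  have eq: "codes (similarity_boundary N f K) = (\<Union>(j, k)\<in>?P. codes (overlap j k))"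
    unfolding similarity_boundary_eq by (auto simp: codes_def)
  have ev: "codes (overlap j k) \<in> code.events" if "j \<in> {1..N}" "k \<in> {1..N}" for j k
    using that by (intro codes_sets closed_overlap overlap_subset)
  have ev': "codes (similarity_boundary N f K) \<in> code.events"
    by (intro codes_sets closed_similarity_boundary similarity_boundary_subset)
  have "code.prob (codes (similarity_boundary N f K)) = 0 \<longleftrightarrow>
    (\<forall>j\<in>{1..N}. \<forall>k\<in>{1..N}. k \<noteq> j \<longrightarrow> code.prob (codes (overlap j k)) = 0)"
  proof
    assume "code.prob (codes (similarity_boundary N f K)) = 0"
    moreover have "codes (overlap j k) \<subseteq> codes (similarity_boundary N f K)"
      if "j \<in> {1..N}" "k \<in> {1..N}" "k \<noteq> j" for j k
      unfolding eq by (rule order_trans[OF _ UN_upper[of "(j, k)"]]) (use that in simp_all)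
    ultimately show "\<forall>j\<in>{1..N}. \<forall>k\<in>{1..N}. k \<noteq> j \<longrightarrow> code.prob (codes (overlap j k)) = 0"
      using ev' by (blast intro: null_mono)
  next
    assume "\<forall>j\<in>{1..N}. \<forall>k\<in>{1..N}. k \<noteq> j \<longrightarrow> code.prob (codes (overlap j k)) = 0"
    then show "code.prob (codes (similarity_boundary N f K)) = 0"
      unfolding eq by (intro null_UN finite_pairs) (auto simp: ev)
  qed
  also have "\<dots> \<longleftrightarrow> essentially_disjoint"
  proof -
    have "code.prob (codes (overlap j k)) = 0 \<longleftrightarrow> code.prob (cylinder N [j] \<inter> codes (f k ` K)) = 0"
      if "j \<in> {1..N}" "k \<in> {1..N}" for j k
      using r_pos[OF that(1)] by (simp add: prob_codes_overlap[OF that])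
    then show ?thesis unfolding essentially_disjoint_def by blast
  qed
  finally show ?thesis
    by (simp add: measure_image closed_similarity_boundary similarity_boundary_subset)
qed

text \<open>Let \<open>A\<close> be the set of codes of boundary points. By inverse invariance
  \<open>A\<close> fills at most the fraction \<open>prob A\<close> of any cylinder, and it misses
  the cylinder of a word \<open>w\<close> whose image avoids the boundary. Summing over words of the
  length of \<open>w\<close> gives \<open>prob A \<le> (1 - prob (cylinder N w)) * prob A\<close>,
  which forces \<open>prob A = 0\<close>.\<close>

lemma measure_boundary_eq_0:
  assumes inv: "\<And>i. i \<in> {1..N} \<Longrightarrow> f i -` similarity_boundary N f K \<inter> K \<subseteq> similarity_boundary N f K"
    and U: "K - similarity_boundary N f K \<noteq> {}"
  shows "measure \<mu> (similarity_boundary N f K) = 0"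
proof -
  let ?B = "similarity_boundary N f K"
  have "openin (top_of_set K) (K - K \<inter> ?B)"
    by (intro openin_diff openin_subtopology_self closedin_closed_Int closed_similarity_boundary)
  then have "openin (top_of_set K) (K - ?B)" by (simp add: Diff_Int)
  then obtain w where w: "w \<in> lists {1..N}" "foldr f w ` K \<subseteq> K - ?B"
    using word_in_open[OF bounded_K K_subset f_K _ U] by blast
  have inv_word: "x \<in> ?B" if "v \<in> lists {1..N}" "x \<in> K" "foldr f v x \<in> ?B" for v x
    using that
  proof (induction v rule: list.induct)
    case (Cons i v)
    have v: "v \<in> lists {1..N}" "i \<in> {1..N}" using Cons.prems(1) by simp_all
    have "foldr f v x \<in> K" using foldr_f_K[OF v(1)] Cons.prems(2) by blast
    moreover have "f i (foldr f v x) \<in> ?B" using Cons.prems(3) by simp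
    ultimately have "foldr f v x \<in> ?B" using inv[OF v(2)] by blast
    then show ?case by (rule Cons.IH[OF v(1) Cons.prems(2)])
  qed simp
  define A where "A = codes ?B"
  have A: "A \<in> code.events"
    unfolding A_def by (intro codes_sets closed_similarity_boundary similarity_boundary_subset)
  have le: "code.prob (A \<inter> cylinder N v) \<le> code.prob (cylinder N v) * code.prob A"
    if v: "v \<in> lists {1..N}" for v
  proof -
    have "A \<inter> cylinder N v \<subseteq> cylinder N v \<inter> {\<omega>. shift (length v) \<omega> \<in> A}"
    proof (intro subsetI IntI CollectI)
      fix \<omega> assume \<omega>: "\<omega> \<in> A \<inter> cylinder N v"
      then have \<omega>': "\<omega> \<in> code_space N" "map \<omega> [0..<length v] = v" "code_map f K \<omega> \<in> ?B"
        by (simp_all only: A_def codes_def cylinder_iff Int_iff mem_Collect_eq)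
      have shift: "shift (length v) \<omega> \<in> code_space N" by (rule shift_in_code_space[OF \<omega>'(1)])
      have "foldr f v (code_map f K (shift (length v) \<omega>)) \<in> ?B"
        using \<omega>'(3) unfolding code_map_shift[OF \<omega>'(1), of "length v"] \<omega>'(2) .
      then have "code_map f K (shift (length v) \<omega>) \<in> ?B"
        by (rule inv_word[OF v code_map_in_K[OF shift]])
      then show "shift (length v) \<omega> \<in> A" using shift by (simp add: A_def codes_def)
    qed auto
    moreover have "cylinder N v \<inter> {\<omega>. shift (length v) \<omega> \<in> A} \<in> code.events"
    proof -
      have "cylinder N v \<inter> (shift (length v) -` A \<inter> space \<nu>) \<in> code.events"
        using measurable_sets[OF code.shift_measurable A] by blast
      moreover have "cylinder N v \<inter> (shift (length v) -` A \<inter> space \<nu>) =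
          cylinder N v \<inter> {\<omega>. shift (length v) \<omega> \<in> A}" by (auto simp: cylinder_iff)
      ultimately show ?thesis by simp
    qed
    ultimately have "code.prob (A \<inter> cylinder N v) \<le> code.prob (cylinder N v \<inter> {\<omega>. shift (length v) \<omega> \<in> A})"
      by (rule code.finite_measure_mono)
    then show ?thesis by (simp add: code.prob_cylinder_shift[OF v A])
  qed
  have empty: "A \<inter> cylinder N w = {}"
    using cylinder_subset_codes[of w] w(2) by (auto simp: A_def codes_def)
  define n where "n = length w"
  have wn: "w \<in> words {1..N} n" using w by (simp add: words_def n_def)
  have "A = (\<Union>v\<in>words {1..N} n. A \<inter> cylinder N v)"
  proof (intro equalityI subsetI)
    fix \<omega> assume \<omega>: "\<omega> \<in> A"
    then have "\<omega> \<in> code_space N" by (simp add: A_def codes_def)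
    then have "map \<omega> [0..<n] \<in> words {1..N} n" "\<omega> \<in> cylinder N (map \<omega> [0..<n])"
      using prefix_in_lists[of \<omega> N n] by (auto simp: words_def cylinder_iff)
    then show "\<omega> \<in> (\<Union>v\<in>words {1..N} n. A \<inter> cylinder N v)" using \<omega> by blast
  qed auto
  also have "code.prob \<dots> \<le> (\<Sum>v\<in>words {1..N} n. code.prob (A \<inter> cylinder N v))"
    using A by (intro code.finite_measure_subadditive_finite) auto
  also have "\<dots> = (\<Sum>v\<in>words {1..N} n - {w}. code.prob (A \<inter> cylinder N v))"
    using empty wn by (subst sum.remove[OF _ wn]) auto
  also have "\<dots> \<le> (\<Sum>v\<in>words {1..N} n - {w}. code.prob (cylinder N v) * code.prob A)"
    by (intro sum_mono le) (auto simp: words_def)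
  also have "\<dots> = (\<Sum>v\<in>words {1..N} n - {w}. code.prob (cylinder N v)) * code.prob A"
    by (simp add: sum_distrib_right)
  also have "(\<Sum>v\<in>words {1..N} n - {w}. code.prob (cylinder N v)) =
      (\<Sum>v\<in>words {1..N} n. code.prob (cylinder N v)) - code.prob (cylinder N w)"
    using wn by (simp add: sum_diff1)
  also have "(\<Sum>v\<in>words {1..N} n. code.prob (cylinder N v)) = (\<Sum>v\<in>words {1..N} n. ratio v powr \<alpha>)"
    by (intro sum.cong) (auto simp: words_def code.prob_cylinder)
  also have "\<dots> = 1" by (simp add: sum_ratio_powr \<alpha>)
  finally have "code.prob (cylinder N w) * code.prob A \<le> 0" by (simp add: algebra_simps)
  then have "code.prob A = 0"
    using code.prob_cylinder_pos[OF w(1)] measure_nonneg[of \<nu> A] by (simp add: mult_le_0_iff)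
  then show ?thesis
    by (simp add: A_def measure_image closed_similarity_boundary similarity_boundary_subset)
qed

text \<open>Every code represents a point of \<open>K\<close>, so \<open>K\<close> has measure 1 and
  a null boundary cannot exhaust it.\<close>

lemma boundary_neq_K:
  assumes "measure \<mu> (similarity_boundary N f K) = 0"
  shows "K - similarity_boundary N f K \<noteq> {}"
proof
  assume "K - similarity_boundary N f K = {}"
  then have eq: "similarity_boundary N f K = K" using similarity_boundary_subset by blast
  have "codes K = space \<nu>" by (auto simp: codes_def code_map_in_K)
  then have "measure \<mu> K = 1"
    using code.prob_space by (simp add: measure_image compact_imp_closed compact_K)
  then show False using assms eq by simp
qed

text \<open>For the complement of the boundary, inverse invariance says exactly that each
  \<open>f i\<close> maps it into itself, and a point of it sent by \<open>f i\<close> into the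
  image of \<open>f j\<close> would lie in \<open>overlap i j\<close>, hence in the
  boundary.\<close>

lemma SOSC_inI:
  assumes inv: "\<And>i. i \<in> {1..N} \<Longrightarrow> f i -` similarity_boundary N f K \<inter> K \<subseteq> similarity_boundary N f K"
    and U: "K - similarity_boundary N f K \<noteq> {}"
  shows "SOSC_in N f K"
  unfolding SOSC_in_def
proof (intro exI[of _ "K - similarity_boundary N f K"] conjI ballI impI U Diff_subset)
  let ?B = "similarity_boundary N f K"
  have "openin (top_of_set K) (K - K \<inter> ?B)"
    by (intro openin_diff openin_subtopology_self closedin_closed_Int closed_similarity_boundary)
  then show "openin (top_of_set K) (K - ?B)" by (simp add: Diff_Int)
  fix i assume i: "i \<in> {1..N}"
  show "f i ` (K - ?B) \<subseteq> K - ?B" using inv[OF i] f_K[OF i] by blast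
  fix j assume "j \<in> {1..N}" "i \<noteq> j"
  then have "overlap i j \<subseteq> ?B" unfolding similarity_boundary_eq using i by blast
  then show "f i ` (K - ?B) \<inter> f j ` K = {}" by (auto simp: overlap_def)
qed

end

theorem theorem3p5:
  fixes f :: "nat \<Rightarrow> 'a::complete_space \<Rightarrow> 'a"
    and r :: "nat \<Rightarrow> real"
    and N :: nat
    and \<alpha> :: real
    and K B U :: "'a set"
    and \<mu> :: "'a measure"
  assumes sim: "\<And>i. i \<in> {1..N} \<Longrightarrow> contracting_similitude (r i) (f i)"
    and K: "invariant_set N f K"
    and \<alpha>: "similarity_dimension N r \<alpha>"
    and \<mu>: "\<mu> = image_measure N f r \<alpha> K"
    and B: "B = similarity_boundary N f K"
    and U: "U = K - B"
    and inverse_invariant: "\<And>i. i \<in> {1..N} \<Longrightarrow> f i -` B \<inter> K \<subseteq> B"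
  shows "(SOSC_in N f K \<longleftrightarrow> hausdorff_dim K = ereal \<alpha>) \<and>
         (hausdorff_dim K = ereal \<alpha> \<longleftrightarrow> U \<noteq> {}) \<and>
         (U \<noteq> {} \<longleftrightarrow> top_of_set K interior_of B = {}) \<and>
         (top_of_set K interior_of B = {} \<longleftrightarrow>
            (\<forall>i\<in>{1..N}. measure \<mu> (f i ` K) = r i powr \<alpha>)) \<and>
         ((\<forall>i\<in>{1..N}. measure \<mu> (f i ` K) = r i powr \<alpha>) \<longleftrightarrow>
            (\<forall>i\<in>{1..N}. \<forall>j\<in>{1..N}. i \<noteq> j \<longrightarrow> measure \<mu> (f i ` K \<inter> f j ` K) = 0)) \<and>
         ((\<forall>i\<in>{1..N}. \<forall>j\<in>{1..N}. i \<noteq> j \<longrightarrow> measure \<mu> (f i ` K \<inter> f j ` K) = 0) \<longleftrightarrow>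
            measure \<mu> B = 0)"
proof -
  have inv: "K \<noteq> {}" "compact K" "K = (\<Union>i\<in>{1..N}. f i ` K)"
    using K by (auto simp only: invariant_set_def)
  interpret ifs N f r K \<alpha>
  proof
    show "f i ` K \<subseteq> K" if "i \<in> {1..N}" for i using inv(3) that by blast
  qed (use sim inv \<alpha> in \<open>auto simp only: similarity_dimension_def finite_atLeastAtMost\<close>)
  \<comment> \<open>Facts 1 to 4 form a cycle through the open set condition, the dimension, the
    empty interior and \<open>U \<noteq> {}\<close>. Fact 5 attaches the measure conditions, which
    are equivalent to one another through \<open>essentially_disjoint\<close>.\<close>
  have 1: "SOSC_in N f K \<Longrightarrow> hausdorff_dim K = ereal \<alpha>"
    by (rule SOSC_imp_hausdorff_dim)
  have 2: "hausdorff_dim K = ereal \<alpha> \<Longrightarrow> top_of_set K interior_of B = {}"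
    using hausdorff_dim_less by (auto simp: B)
  have 3: "U \<noteq> {}" if "top_of_set K interior_of B = {}"
  proof
    assume "U = {}"
    then have "B = K" using similarity_boundary_subset by (auto simp: U B)
    then show False using that inv(1) interior_of_topspace[of "top_of_set K"] by simp
  qed
  have 4: "U \<noteq> {} \<Longrightarrow> SOSC_in N f K"
    unfolding U B by (rule SOSC_inI[OF inverse_invariant[unfolded B]])
  have 5: "U \<noteq> {} \<longleftrightarrow> measure \<mu> B = 0"
    unfolding U B \<mu> using measure_boundary_eq_0[OF inverse_invariant[unfolded B]] boundary_neq_K by blast
  show ?thesis
    using 1 2 3 4 5 measure_f_K_iff essentially_disjoint_iff measure_Int_iff measure_boundary_iff
    unfolding \<mu>[symmetric] B[symmetric] by blast
qed

end
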